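(* Under the standing assumptions in the context, assume that $\eta,\theta,t>0$, $\delta\in(0,1]$ and $x^0\in C$. Then the procedure $\mathtt{ICG}(x^0,t,\eta,\delta,\theta)$ (defined in the context) requires at most $$\tilde N(x^0,\eta,\delta,\theta):=\left\lceil\frac{5.3\,\big(t\delta(\Delta_t(x^0)-\theta)+\nu+t\Omega_g\big)}{\delta}\,\log\left(\min\left\{\frac{10.6\,t\,\Delta_t(x^0)}{(1-10.6\,t\,\theta)_+},\ \frac{\Delta_t(x^0)}{\eta}\right\}\right)\right\rceil+\left\lceil\frac{12(\nu+t\Omega_g)^2}{t\delta^2}\left(\frac1\eta-\frac{1}{\Delta_t(x^0)-\theta}\right)_+\right\rceil+1$$ iterations in order to reach a point $x^k$ satisfying $\Delta_t(x^k)\le\eta+\theta$ for the first time.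
   Context: **Setting.** $E$ and $H$ are finite-dimensional Euclidean spaces; $E^*$ is the dual of $E$. For a differentiable function $f$, $f'(x)[h]$, $f''(x)[h_1,h_2]$, $f'''(x)[h_1,h_2,h_3]$ denote directional derivatives. For an open convex set $Q$, a function $f$ is self-concordant on $Q$ if it is (convex and) $C^3$ on $Q$ and $|f'''(x)[h,h,h]|\le 2(f''(x)[h,h])^{3/2}$ for all $x\in Q$ and all directions $h$. If $\mathrm{cl}(Q)$ is a closed convex pointed cone, $f$ is a $\nu$-canonical barrier for this cone (written $f\in\mathcal B_\nu$) if it is a self-concordant barrier on $Q$ (value $+\infty$ outside $Q$, tending to $+\infty$ at the boundary of $Q$) and $f(\tau x)=f(x)-\nu\log\tau$ for all $x\in Q$, $\tau>0$. **Standing assumptions.** (1) $g:E\to(-\infty,\infty]$ is proper, closed, convex and continuous on $\mathrm{dom}(g)$, and $\Omega_g:=\max_{x,y\in \mathrm{dom}(g)\cap X}|g(x)-g(y)|$ is finite. (2) $K\subset H$ is a closed convex pointed cone with nonempty interior, with a $\nu$-canonical barrier $f\in\mathcal B_\nu(K)$. (3) $P:E\to H$ is linear, and $F(x):=f(P(x))$ is a $\nu$-canonical barrier on the cone $P^{-1}(K)$; $\mathrm{dom}(F)=\mathrm{int}\,P^{-1}(K)$. (4) $X\subset E$ is nonempty, compact and convex, and $C:=X\cap\mathrm{dom}(F)\cap\mathrm{dom}(g)\ne\emptyset$. **Potential function.** For $t>0$, $V_t(x):=\frac1tF(x)+g(x)$, $z^*(t)\in\mathrm{argmin}_{x\in X}V_t(x)$,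 and $\Delta_t(x):=V_t(x)-V_t(z^*(t))$. **Inexact oracle.** For $t>0$ and $x\in C$ let $\Gamma_t(x,s):=t^{-1}F'(x)[x-s]+g(x)-g(s)$ and $\mathrm{Gap}_t(x):=\max_{s\in X}\Gamma_t(x,s)$. For $\delta\in(0,1]$, $\theta>0$, a $(\delta,\theta)$-inexact linear minimization oracle returns, for each $x\in C$, a point $\tilde s_t(x)\in C$ with $$\widetilde{\mathrm{Gap}}_t(x):=\Gamma_t(x,\tilde s_t(x))\ \ge\ \delta\,(\mathrm{Gap}_t(x)-\theta).$$ **Procedure $\mathtt{ICG}(x^0,t,\eta,\delta,\theta)$.** With $\tilde s_t$ given by a $(\delta,\theta)$-inexact oracle, let $\tilde e_t(x):=\big(F''(x)[\tilde s_t(x)-x,\tilde s_t(x)-x]\big)^{1/2}$ and $$\tilde\alpha_t(x):=\min\Big\{1,\frac{t\,\widetilde{\mathrm{Gap}}_t(x)}{\tilde e_t(x)\,(\tilde e_t(x)+t\,\widetilde{\mathrm{Gap}}_t(x))}\Big\}.$$ For $k=0,1,\dots$: if $\widetilde{\mathrm{Gap}}_t(x^k)>\eta\delta$, set $x^{k+1}=x^k+\tilde\alpha_t(x^k)(\tilde s_t(x^k)-x^k)$; otherwise stop and return the iteration index $k$ and the point $x^k$. **Notation.** $(a)_+=\max\{a,0\}$; when $(1-10.6\,t\theta)_+=0$, the first entry of the minimum is read as $+\infty$.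
   Formalization: The first ceiling in Ñ is replaced by its positive part max{0, ⌈…⌉}: it can be negative, and then the printed bound is false (it can equal −10 when at least one iteration is needed). Whenever that ceiling is nonnegative the bound is exactly the printed one. *)

theory Defs
  imports "HOL-Analysis.Analysis"
begin

definition D1 :: "('a::real_normed_vector \<Rightarrow> real) \<Rightarrow> 'a \<Rightarrow> 'a \<Rightarrow> real" where
  "D1 f x h = frechet_derivative f (at x) h"

definition D2 :: "('a::real_normed_vector \<Rightarrow> real) \<Rightarrow> 'a \<Rightarrow> 'a \<Rightarrow> 'a \<Rightarrow> real" where
  "D2 f x h1 h2 = D1 (\<lambda>y. D1 f y h1) x h2"

definition D3 :: "('a::real_normed_vector \<Rightarrow> real) \<Rightarrow> 'a \<Rightarrow> 'a \<Rightarrow> 'a \<Rightarrow> 'a \<Rightarrow> real" where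
  "D3 f x h1 h2 h3 = D1 (\<lambda>y. D2 f y h1 h2) x h3"

text \<open>In finite dimension, and for open \<open>Q\<close>, the following is the usual notion of a
  three times continuously differentiable function.\<close>

definition C3_on :: "'a::euclidean_space set \<Rightarrow> ('a \<Rightarrow> real) \<Rightarrow> bool" where
  "C3_on Q f \<longleftrightarrow>
     (\<forall>x\<in>Q. f differentiable (at x)) \<and>
     (\<forall>h. \<forall>x\<in>Q. (\<lambda>y. D1 f y h) differentiable (at x)) \<and>
     (\<forall>h k. \<forall>x\<in>Q. (\<lambda>y. D2 f y h k) differentiable (at x)) \<and>
     (\<forall>h k l. continuous_on Q (\<lambda>y. D3 f y h k l))"

definition self_concordant_on :: "'a::euclidean_space set \<Rightarrow> ('a \<Rightarrow> real) \<Rightarrow> bool" where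
  "self_concordant_on Q f \<longleftrightarrow>
     open Q \<and> convex_on Q f \<and> C3_on Q f \<and>
     (\<forall>x\<in>Q. \<forall>h. \<bar>D3 f x h h h\<bar> \<le> 2 * (D2 f x h h) powr (3/2))"

definition edom :: "('a \<Rightarrow> ereal) \<Rightarrow> 'a set" where
  "edom f = {x. f x < \<infinity>}"

definition re :: "('a \<Rightarrow> ereal) \<Rightarrow> 'a \<Rightarrow> real" where
  "re f x = real_of_ereal (f x)"

definition epi :: "('a \<Rightarrow> ereal) \<Rightarrow> ('a \<times> real) set" where
  "epi g = {(x, r). g x \<le> ereal r}"

definition proper_fun :: "('a \<Rightarrow> ereal) \<Rightarrow> bool" where
  "proper_fun g \<longleftrightarrow> (\<forall>x. g x \<noteq> -\<infinity>) \<and> edom g \<noteq> {}"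

definition regular_cone :: "'a::euclidean_space set \<Rightarrow> bool" where
  "regular_cone K \<longleftrightarrow>
     closed K \<and> convex K \<and> cone K \<and> K \<inter> uminus ` K \<subseteq> {0} \<and> interior K \<noteq> {}"

definition self_concordant_barrier :: "'a::euclidean_space set \<Rightarrow> ('a \<Rightarrow> ereal) \<Rightarrow> bool" where
  "self_concordant_barrier Q f \<longleftrightarrow>
     (\<forall>x\<in>Q. \<bar>f x\<bar> \<noteq> \<infinity>) \<and> (\<forall>x. x \<notin> Q \<longrightarrow> f x = \<infinity>) \<and>
     self_concordant_on Q (re f) \<and>
     (\<forall>b\<in>frontier Q. (f \<longlongrightarrow> \<infinity>) (at b within Q))"

definition canonical_barrier :: "real \<Rightarrow> 'a::euclidean_space set \<Rightarrow> ('a \<Rightarrow> ereal) \<Rightarrow> bool" where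
  "canonical_barrier \<nu> K f \<longleftrightarrow>
     regular_cone K \<and> self_concordant_barrier (interior K) f \<and>
     (\<forall>x\<in>interior K. \<forall>\<tau>>0. f (\<tau> *\<^sub>R x) = f x - ereal (\<nu> * ln \<tau>))"

definition feasible :: "('a \<Rightarrow> ereal) \<Rightarrow> ('a \<Rightarrow> ereal) \<Rightarrow> 'a set \<Rightarrow> 'a set" where
  "feasible F g X = X \<inter> edom F \<inter> edom g"

text \<open>The maximum in \<open>\<Omega>\<^sub>g\<close> is rendered as a supremum, so that attainment need not be assumed.\<close>

definition Omega :: "('a \<Rightarrow> ereal) \<Rightarrow> 'a set \<Rightarrow> ereal" where
  "Omega g X = (SUP (x, y) \<in> (edom g \<inter> X) \<times> (edom g \<inter> X). \<bar>g x - g y\<bar>)"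

definition potential :: "('a \<Rightarrow> ereal) \<Rightarrow> ('a \<Rightarrow> ereal) \<Rightarrow> real \<Rightarrow> 'a \<Rightarrow> ereal" where
  "potential F g t x = ereal (1 / t) * F x + g x"

definition Gam :: "('a::euclidean_space \<Rightarrow> ereal) \<Rightarrow> ('a \<Rightarrow> ereal) \<Rightarrow> real \<Rightarrow> 'a \<Rightarrow> 'a \<Rightarrow> ereal" where
  "Gam F g t x s = ereal (1 / t * D1 (re F) x (x - s)) + (g x - g s)"

text \<open>For feasible \<open>x\<close>, \<open>Gam F g t x\<close> is upper semicontinuous (with value \<open>-\<infinity>\<close> off the domain
  of \<open>g\<close>), so over a compact \<open>X\<close> the supremum is a maximum.\<close>

definition Gap :: "('a::euclidean_space \<Rightarrow> ereal) \<Rightarrow> ('a \<Rightarrow> ereal) \<Rightarrow> 'a set \<Rightarrow> real \<Rightarrow> 'a \<Rightarrow> ereal" where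
  "Gap F g X t x = (SUP s\<in>X. Gam F g t x s)"

definition inexact_oracle ::
  "('a::euclidean_space \<Rightarrow> ereal) \<Rightarrow> ('a \<Rightarrow> ereal) \<Rightarrow> 'a set \<Rightarrow> real \<Rightarrow> real \<Rightarrow> real \<Rightarrow> ('a \<Rightarrow> 'a) \<Rightarrow> bool"
  where
  "inexact_oracle F g X t \<delta> \<theta> s \<longleftrightarrow>
     (\<forall>x\<in>feasible F g X. s x \<in> feasible F g X \<and>
        Gam F g t x (s x) \<ge> ereal \<delta> * (Gap F g X t x - ereal \<theta>))"

text \<open>Below, \<open>s\<close> is the map returning the inexact linear minimizers.\<close>

definition tGap :: "('a::euclidean_space \<Rightarrow> ereal) \<Rightarrow> ('a \<Rightarrow> ereal) \<Rightarrow> real \<Rightarrow> ('a \<Rightarrow> 'a) \<Rightarrow> 'a \<Rightarrow> ereal" where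
  "tGap F g t s x = Gam F g t x (s x)"

definition te :: "('a::euclidean_space \<Rightarrow> ereal) \<Rightarrow> ('a \<Rightarrow> 'a) \<Rightarrow> 'a \<Rightarrow> real" where
  "te F s x = sqrt (D2 (re F) x (s x - x) (s x - x))"

definition step_size :: "('a::euclidean_space \<Rightarrow> ereal) \<Rightarrow> ('a \<Rightarrow> ereal) \<Rightarrow> real \<Rightarrow> ('a \<Rightarrow> 'a) \<Rightarrow> 'a \<Rightarrow> real" where
  "step_size F g t s x =
     (let e = te F s x; G = re (tGap F g t s) x
      in min 1 (t * G / (e * (e + t * G))))"

text \<open>\<open>icg F g t s \<eta> \<delta> x0 k\<close> is \<open>Some x\<close> if the procedure generates the \<open>k\<close>-th iterate \<open>x\<close>, and
  \<open>None\<close> if it has stopped at an earlier iterate.\<close>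

primrec icg ::
  "('a::euclidean_space \<Rightarrow> ereal) \<Rightarrow> ('a \<Rightarrow> ereal) \<Rightarrow> real \<Rightarrow> ('a \<Rightarrow> 'a) \<Rightarrow> real \<Rightarrow> real \<Rightarrow> 'a \<Rightarrow> nat \<Rightarrow> 'a option"
  where
  "icg F g t s \<eta> \<delta> x0 0 = Some x0"
| "icg F g t s \<eta> \<delta> x0 (Suc k) =
     (case icg F g t s \<eta> \<delta> x0 k of
        None \<Rightarrow> None
      | Some x \<Rightarrow>
          if tGap F g t s x > ereal (\<eta> * \<delta>)
          then Some (x + step_size F g t s x *\<^sub>R (s x - x))
          else None)"

text \<open>In the following, \<open>\<Omega>\<close> and \<open>\<Delta>\<close> stand for \<open>\<Omega>\<^sub>g\<close> and \<open>\<Delta>\<^sub>t(x\<^sup>0)\<close>.\<close>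

definition log_arg :: "real \<Rightarrow> real \<Rightarrow> real \<Rightarrow> real \<Rightarrow> real" where
  "log_arg t \<eta> \<theta> \<Delta> =
     (if max (1 - 10.6 * t * \<theta>) 0 = 0 then \<Delta> / \<eta>
      else min (10.6 * t * \<Delta> / max (1 - 10.6 * t * \<theta>) 0) (\<Delta> / \<eta>))"

text \<open>The first summand bounds the number of iterations in the phase of linear convergence; that
  phase is empty when the expression is negative (logarithm of a number below 1, or a negative
  factor in front of it), so the summand is then 0. Without \<open>max 0\<close> the sum can be negative even
  though at least one iteration is needed: take \<open>F = -ln\<close> on the positive half-line, \<open>g = 0\<close>,
  \<open>X = [1, 2]\<close>, exact linear minimization \<open>s(x) = 2\<close>, \<open>t = \<nu> = \<delta> = 1\<close>, \<open>\<Delta> = 0.001\<close> (that is,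
  \<open>x\<^sup>0 = 2 exp (-0.001)\<close>), \<open>\<eta> = 0.000998\<close>, \<open>\<theta> = 0.000001\<close>; the sum would be \<open>-24 + 13 + 1\<close>.\<close>

definition icg_bound :: "real \<Rightarrow> real \<Rightarrow> real \<Rightarrow> real \<Rightarrow> real \<Rightarrow> real \<Rightarrow> real \<Rightarrow> int" where
  "icg_bound \<nu> \<Omega> t \<eta> \<delta> \<theta> \<Delta> =
     max 0 \<lceil>5.3 * (t * \<delta> * (\<Delta> - \<theta>) + \<nu> + t * \<Omega>) / \<delta> * ln (log_arg t \<eta> \<theta> \<Delta>)\<rceil>
     + \<lceil>12 * (\<nu> + t * \<Omega>)\<^sup>2 / (t * \<delta>\<^sup>2) * max (1 / \<eta> - 1 / (\<Delta> - \<theta>)) 0\<rceil>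
     + 1"

end

theory Submission
  imports Defs
begin

text \<open>
  Write \<open>A = \<nu> + t \<Omega>\<close>, \<open>h\<^sub>j = \<Delta>(x\<^sup>j) - \<theta>\<close> and \<open>\<gamma>\<close> for \<open>t\<close> times the approximate gap. Log-homogeneity
  gives \<open>F''(x)[s - x, s - x] = F''(x)[s, s] + 2 F'(x)[s] + \<nu>\<close>, and the first term is at most
  \<open>(F'(x)[s])\<^sup>2\<close>; hence the local norm \<open>e\<close> of \<open>s - x\<close> is at most \<open>A + \<gamma>\<close>. The self-concordant upper
  bound on \<open>F\<close> then turns the chosen step into a decrease of \<open>t \<Delta>\<close> by \<open>\<omega>(\<gamma> / e)\<close> with
  \<open>\<omega>(u) = u - ln (1 + u)\<close>, or by \<open>\<gamma> / 2\<close> if the step is a full one. If \<open>\<gamma> \<ge> A\<close> this contracts \<open>h\<^sub>j\<close> by a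
  fixed factor and lowers \<open>\<Delta>\<close> by at least \<open>1 / (10.6 t)\<close>, so \<open>\<Delta>\<close> was still above that value before the
  last such step; otherwise \<open>1 / h\<^sub>j\<close> grows by a fixed amount. As \<open>h\<^sub>j\<close> never increases, the two
  kinds of steps can be counted separately in whichever order they occur.
\<close>

section \<open>Self-concordant functions along segments\<close>

lemma DERIV_along_line:
  assumes "f differentiable (at (x + \<tau> *\<^sub>R h))"
  shows "((\<lambda>r. f (x + r *\<^sub>R h)) has_real_derivative D1 f (x + \<tau> *\<^sub>R h) h) (at \<tau>)"
proof -
  let ?f' = "frechet_derivative f (at (x + \<tau> *\<^sub>R h))"
  have *: "(f has_derivative ?f') (at (x + \<tau> *\<^sub>R h))"
    using assms frechet_derivative_works by blast
  have "((\<lambda>r. f (x + r *\<^sub>R h)) has_derivative (\<lambda>r. ?f' (r *\<^sub>R h))) (at \<tau>)"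
    by (rule has_derivative_compose[of "\<lambda>r. x + r *\<^sub>R h", OF _ *])
       (auto intro!: derivative_eq_intros)
  moreover have "?f' (r *\<^sub>R h) = D1 f (x + \<tau> *\<^sub>R h) h * r" for r
    using linear_cmul[OF has_derivative_linear[OF *], of r h] by (simp add: D1_def)
  ultimately show ?thesis
    by (simp add: has_field_derivative_def)
qed

lemma linear_D1: "f differentiable (at x) \<Longrightarrow> linear (D1 f x)"
  unfolding D1_def[abs_def] using frechet_derivative_works has_derivative_linear by blast

section \<open>The differential inequality for the second derivative along a segment\<close>

context
  fixes u u' :: "real \<Rightarrow> real" and T :: real
  assumes T: "0 \<le> T"
    and deriv: "\<And>\<tau>. 0 \<le> \<tau> \<Longrightarrow> \<tau> \<le> T \<Longrightarrow> (u has_real_derivative u' \<tau>) (at \<tau>)"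
    and nonneg: "\<And>\<tau>. 0 \<le> \<tau> \<Longrightarrow> \<tau> \<le> T \<Longrightarrow> 0 \<le> u \<tau>"
    and growth: "\<And>\<tau>. 0 \<le> \<tau> \<Longrightarrow> \<tau> \<le> T \<Longrightarrow> \<bar>u' \<tau>\<bar> \<le> 2 * u \<tau> powr (3/2)"
begin

text \<open>On the compact interval \<open>u\<close> is bounded by some \<open>B\<close>, and
  \<open>u powr (3/2)\<close> is \<open>u * sqrt u\<close>, so the superlinear growth condition
  becomes a linear one, as a Gronwall argument requires.\<close>

lemma growth_linear:
  obtains M where "\<And>\<tau>. 0 \<le> \<tau> \<Longrightarrow> \<tau> \<le> T \<Longrightarrow> \<bar>u' \<tau>\<bar> \<le> M * u \<tau>"
proof -
  have "continuous_on {0..T} u"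
    by (intro DERIV_atLeastAtMost_imp_continuous_on) (use deriv in auto)
  then have "bounded (u ` {0..T})"
    by (intro compact_imp_bounded compact_continuous_image) auto
  then obtain B where "\<forall>y\<in>u ` {0..T}. norm y \<le> B"
    unfolding bounded_iff by blast
  then have B: "\<bar>u \<tau>\<bar> \<le> B" if "0 \<le> \<tau>" "\<tau> \<le> T" for \<tau>
    using that by auto
  have "\<bar>u' \<tau>\<bar> \<le> (2 * sqrt B) * u \<tau>" if "0 \<le> \<tau>" "\<tau> \<le> T" for \<tau>
  proof -
    have "u \<tau> powr (3/2) = u \<tau> * sqrt (u \<tau>)"
      using nonneg[OF that] powr_add[of "u \<tau>" 1 "1/2"]
      by (cases "u \<tau> = 0") (auto simp: powr_half_sqrt)
    also have "\<dots> \<le> u \<tau> * sqrt B"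
      using B[OF that] nonneg[OF that] by (intro mult_left_mono) auto
    finally show ?thesis using growth[OF that] by (simp add: mult_ac)
  qed
  then show thesis by (rule that)
qed

text \<open>Gronwall in both directions: \<open>u\<close> times \<open>exp (- M * \<tau>)\<close> is
  nonincreasing and \<open>u\<close> times \<open>exp (M * \<tau>)\<close> is nondecreasing, so a
  zero at either end forces a zero at the other.\<close>

lemma zero_iff: "u T = 0 \<longleftrightarrow> u 0 = 0"
proof -
  obtain M where M: "\<And>\<tau>. 0 \<le> \<tau> \<Longrightarrow> \<tau> \<le> T \<Longrightarrow> \<bar>u' \<tau>\<bar> \<le> M * u \<tau>"
    using growth_linear by blast
  have "u T * exp (- M * T) \<le> u 0 * exp (- M * 0)"
  proof (rule DERIV_nonpos_imp_nonincreasing[OF T], intro exI conjI)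
    fix \<tau> assume "0 \<le> \<tau>" "\<tau> \<le> T"
    show "((\<lambda>\<tau>. u \<tau> * exp (- M * \<tau>)) has_real_derivative
      (u' \<tau> - M * u \<tau>) * exp (- M * \<tau>)) (at \<tau>)"
      by (auto intro!: derivative_eq_intros deriv \<open>0 \<le> \<tau>\<close> \<open>\<tau> \<le> T\<close> simp: algebra_simps)
    show "(u' \<tau> - M * u \<tau>) * exp (- M * \<tau>) \<le> 0"
      using M[OF \<open>0 \<le> \<tau>\<close> \<open>\<tau> \<le> T\<close>] by (intro mult_nonpos_nonneg) auto
  qed
  moreover have "u 0 * exp (M * 0) \<le> u T * exp (M * T)"
  proof (rule DERIV_nonneg_imp_nondecreasing[OF T], intro exI conjI)
    fix \<tau> assume "0 \<le> \<tau>" "\<tau> \<le> T"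
    show "((\<lambda>\<tau>. u \<tau> * exp (M * \<tau>)) has_real_derivative
      (u' \<tau> + M * u \<tau>) * exp (M * \<tau>)) (at \<tau>)"
      by (auto intro!: derivative_eq_intros deriv \<open>0 \<le> \<tau>\<close> \<open>\<tau> \<le> T\<close> simp: algebra_simps)
    show "0 \<le> (u' \<tau> + M * u \<tau>) * exp (M * \<tau>)"
      using M[OF \<open>0 \<le> \<tau>\<close> \<open>\<tau> \<le> T\<close>] by (intro mult_nonneg_nonneg) auto
  qed
  ultimately show ?thesis
    using nonneg[of 0] nonneg[of T] T by (auto simp: mult_le_0_iff)
qed

end

context
  fixes u u' :: "real \<Rightarrow> real" and T :: real
  assumes T: "0 \<le> T"
    and deriv: "\<And>\<tau>. 0 \<le> \<tau> \<Longrightarrow> \<tau> \<le> T \<Longrightarrow> (u has_real_derivative u' \<tau>) (at \<tau>)"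
    and nonneg: "\<And>\<tau>. 0 \<le> \<tau> \<Longrightarrow> \<tau> \<le> T \<Longrightarrow> 0 \<le> u \<tau>"
    and growth: "\<And>\<tau>. 0 \<le> \<tau> \<Longrightarrow> \<tau> \<le> T \<Longrightarrow> \<bar>u' \<tau>\<bar> \<le> 2 * u \<tau> powr (3/2)"
begin

text \<open>The exponent \<open>-1/2\<close> makes the powers cancel: the derivative of
  \<open>u powr (-1/2)\<close> is \<open>- (1/2) * u powr (-3/2) * u'\<close>, whose modulus the
  growth condition bounds by 1.\<close>

lemma inverse_sqrt_lipschitz:
  assumes "u 0 > 0"
  shows "u T > 0" "\<bar>1 / sqrt (u T) - 1 / sqrt (u 0)\<bar> \<le> T"
proof -
  \<comment> \<open>The context was closed and reopened with the same assumptions so that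
    \<open>zero_iff\<close> applies here with \<open>\<tau>\<close> as the right end of the
    interval.\<close>
  have pos: "u \<tau> > 0" if "0 \<le> \<tau>" "\<tau> \<le> T" for \<tau>
    using zero_iff[of \<tau> u u'] nonneg[of \<tau>] that deriv nonneg growth assms by fastforce
  then show "u T > 0" using T by simp
  have d: "((\<lambda>\<tau>. u \<tau> powr (-1/2)) has_real_derivative - (1/2) * u \<tau> powr (-3/2) * u' \<tau>) (at \<tau>)"
    and b: "\<bar>- (1/2) * u \<tau> powr (-3/2) * u' \<tau>\<bar> \<le> 1" if "0 \<le> \<tau>" "\<tau> \<le> T" for \<tau>
  proof -
    show "((\<lambda>\<tau>. u \<tau> powr (-1/2)) has_real_derivative - (1/2) * u \<tau> powr (-3/2) * u' \<tau>) (at \<tau>)"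
      using DERIV_fun_powr[OF deriv[OF that] pos[OF that], of "-1/2"] by simp
    have "\<bar>- (1/2) * u \<tau> powr (-3/2) * u' \<tau>\<bar> = (1/2) * u \<tau> powr (-3/2) * \<bar>u' \<tau>\<bar>"
      by (simp add: abs_mult)
    also have "\<dots> \<le> (1/2) * u \<tau> powr (-3/2) * (2 * u \<tau> powr (3/2))"
      using growth[OF that] by (intro mult_left_mono) auto
    also have "\<dots> = 1"
      using pos[OF that] by (simp add: powr_add[symmetric])
    finally show "\<bar>- (1/2) * u \<tau> powr (-3/2) * u' \<tau>\<bar> \<le> 1" .
  qed
  have "u T powr (-1/2) - T \<le> u 0 powr (-1/2) - 0"
  proof (rule DERIV_nonpos_imp_nonincreasing[OF T], intro exI conjI)
    fix \<tau> assume \<tau>: "0 \<le> \<tau>" "\<tau> \<le> T"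
    show "((\<lambda>\<tau>. u \<tau> powr (-1/2) - \<tau>) has_real_derivative
        - (1/2) * u \<tau> powr (-3/2) * u' \<tau> - 1) (at \<tau>)"
      by (intro DERIV_diff d \<tau> DERIV_ident)
    show "- (1/2) * u \<tau> powr (-3/2) * u' \<tau> - 1 \<le> 0"
      using b[OF \<tau>] by linarith
  qed
  moreover have "u 0 powr (-1/2) + 0 \<le> u T powr (-1/2) + T"
  proof (rule DERIV_nonneg_imp_nondecreasing[OF T], intro exI conjI)
    fix \<tau> assume \<tau>: "0 \<le> \<tau>" "\<tau> \<le> T"
    show "((\<lambda>\<tau>. u \<tau> powr (-1/2) + \<tau>) has_real_derivative
        - (1/2) * u \<tau> powr (-3/2) * u' \<tau> + 1) (at \<tau>)"
      by (intro DERIV_add d \<tau> DERIV_ident)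
    show "0 \<le> - (1/2) * u \<tau> powr (-3/2) * u' \<tau> + 1"
      using b[OF \<tau>] by linarith
  qed
  moreover
  have "u \<tau> powr (-1/2) = 1 / sqrt (u \<tau>)" if "0 \<le> \<tau>" "\<tau> \<le> T" for \<tau>
    using powr_minus_divide[of "u \<tau>" "1/2"] powr_half_sqrt[of "u \<tau>"] pos[OF that]
    by (simp only: minus_divide_left less_imp_le)
  from this[of 0] this[of T] have "u 0 powr (-1/2) = 1 / sqrt (u 0)" "u T powr (-1/2) = 1 / sqrt (u T)"
    using T by auto
  ultimately show "\<bar>1 / sqrt (u T) - 1 / sqrt (u 0)\<bar> \<le> T"
    by linarith
qed

lemma growth_lower: "u 0 / (1 + T * sqrt (u 0))\<^sup>2 \<le> u T"
proof (cases "u 0 = 0")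
  case True
  then show ?thesis using nonneg[of T] T by simp
next
  case False
  then have u0: "u 0 > 0" using nonneg[of 0] T by simp
  note L = inverse_sqrt_lipschitz[OF this]
  define r q where "r = sqrt (u 0)" and "q = sqrt (u T)"
  have "r > 0" "q > 0" "u 0 = r\<^sup>2" "u T = q\<^sup>2"
    using u0 L(1) by (auto simp: r_def q_def)
  have "1 / q \<le> 1 / r + T" using L(2) by (simp add: r_def q_def)
  also have "\<dots> = (1 + T * r) / r" using \<open>r > 0\<close> by (simp add: field_simps)
  finally have "r / (1 + T * r) \<le> q"
    using \<open>r > 0\<close> \<open>q > 0\<close> T by (simp add: field_simps add_pos_nonneg)
  then have "(r / (1 + T * r))\<^sup>2 \<le> q\<^sup>2"
    using \<open>r > 0\<close> T by (intro power_mono) auto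
  then show ?thesis
    using \<open>r > 0\<close> by (simp add: \<open>u 0 = r\<^sup>2\<close> \<open>u T = q\<^sup>2\<close> power_divide)
qed

text \<open>The assumption keeps \<open>1 / sqrt (u 0) - T\<close> positive, so the Lipschitz bound
  can be inverted; the case \<open>u 0 = 0\<close> rests on \<open>zero_iff\<close>.\<close>

lemma growth_upper:
  assumes "T * sqrt (u 0) < 1"
  shows "u T \<le> u 0 / (1 - T * sqrt (u 0))\<^sup>2"
proof (cases "u 0 = 0")
  case True
  then show ?thesis using zero_iff[OF T deriv nonneg growth] by simp
next
  case False
  then have u0: "u 0 > 0" using nonneg[of 0] T by simp
  note L = inverse_sqrt_lipschitz[OF this]
  define r q where "r = sqrt (u 0)" and "q = sqrt (u T)"
  have *: "r > 0" "q > 0" "u 0 = r\<^sup>2" "u T = q\<^sup>2" "T * r < 1"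
    using u0 L(1) assms by (auto simp: r_def q_def)
  have "(1 - T * r) / r = 1 / r - T" using \<open>r > 0\<close> by (simp add: field_simps)
  also have "\<dots> \<le> 1 / q" using L(2) by (simp add: r_def q_def)
  finally have "q \<le> r / (1 - T * r)"
    using * by (simp add: field_simps)
  then have "q\<^sup>2 \<le> (r / (1 - T * r))\<^sup>2"
    using * by (intro power_mono) auto
  then show ?thesis
    using * by (simp add: power_divide)
qed

end

section \<open>Slope and value of a self-concordant function of one variable\<close>

context
  fixes p p' u u' :: "real \<Rightarrow> real" and T :: real
  assumes T: "0 \<le> T"
    and deriv0: "\<And>\<tau>. 0 \<le> \<tau> \<Longrightarrow> \<tau> \<le> T \<Longrightarrow> (p has_real_derivative p' \<tau>) (at \<tau>)"
    and deriv1: "\<And>\<tau>. 0 \<le> \<tau> \<Longrightarrow> \<tau> \<le> T \<Longrightarrow> (p' has_real_derivative u \<tau>) (at \<tau>)"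
    and deriv2: "\<And>\<tau>. 0 \<le> \<tau> \<Longrightarrow> \<tau> \<le> T \<Longrightarrow> (u has_real_derivative u' \<tau>) (at \<tau>)"
    and nonneg: "\<And>\<tau>. 0 \<le> \<tau> \<Longrightarrow> \<tau> \<le> T \<Longrightarrow> 0 \<le> u \<tau>"
    and growth: "\<And>\<tau>. 0 \<le> \<tau> \<Longrightarrow> \<tau> \<le> T \<Longrightarrow> \<bar>u' \<tau>\<bar> \<le> 2 * u \<tau> powr (3/2)"
begin

text \<open>\<open>growth_lower\<close> integrated once: \<open>- r / (1 + \<tau> * r)\<close> is an
  antiderivative of \<open>u 0 / (1 + \<tau> * r)\<^sup>2\<close>.\<close>

lemma sc_slope_lower: "sqrt (u 0) - sqrt (u 0) / (1 + T * sqrt (u 0)) \<le> p' T - p' 0"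
proof -
  define r where "r = sqrt (u 0)"
  have r: "r \<ge> 0" "u 0 = r\<^sup>2" using nonneg[of 0] T by (auto simp: r_def)
  have "p' 0 + r / (1 + 0 * r) \<le> p' T + r / (1 + T * r)"
  proof (rule DERIV_nonneg_imp_nondecreasing[OF T], intro exI conjI)
    fix \<tau> assume \<tau>: "0 \<le> \<tau>" "\<tau> \<le> T"
    have pos: "1 + \<tau> * r > 0" using r \<tau> by (simp add: add_pos_nonneg)
    show "((\<lambda>\<tau>. p' \<tau> + r / (1 + \<tau> * r)) has_real_derivative u \<tau> - u 0 / (1 + \<tau> * r)\<^sup>2) (at \<tau>)"
      using pos by (auto intro!: derivative_eq_intros deriv1 \<tau> simp: r power2_eq_square)
    show "0 \<le> u \<tau> - u 0 / (1 + \<tau> * r)\<^sup>2"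
      using growth_lower[of \<tau> u u'] \<tau> deriv2 nonneg growth by (simp add: r_def)
  qed
  then show ?thesis by (simp add: r_def)
qed

text \<open>\<open>growth_upper\<close> integrated twice. The first integration gives
  \<open>slope\<close>; for the second, \<open>- \<tau> * r - ln (1 - \<tau> * r)\<close> is an
  antiderivative of \<open>r / (1 - \<tau> * r) - r\<close>.\<close>

lemma sc_value_upper:
  assumes "T * sqrt (u 0) < 1"
  shows "p T \<le> p 0 + T * p' 0 - T * sqrt (u 0) - ln (1 - T * sqrt (u 0))"
proof -
  define r where "r = sqrt (u 0)"
  have r: "r \<ge> 0" "u 0 = r\<^sup>2" "T * r < 1" using nonneg[of 0] T assms by (auto simp: r_def)
  have pos: "1 - \<tau> * r > 0" if "0 \<le> \<tau>" "\<tau> \<le> T" for \<tau>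
    using r mult_right_mono[OF that(2) r(1)] by linarith
  have slope: "p' S - p' 0 \<le> r / (1 - S * r) - r" if S: "0 \<le> S" "S \<le> T" for S
  proof -
    have "p' S - r / (1 - S * r) \<le> p' 0 - r / (1 - 0 * r)"
    proof (rule DERIV_nonpos_imp_nonincreasing[OF S(1)], intro exI conjI)
      fix \<tau> assume "0 \<le> \<tau>" "\<tau> \<le> S"
      then have \<tau>: "0 \<le> \<tau>" "\<tau> \<le> T" using S by auto
      show "((\<lambda>\<tau>. p' \<tau> - r / (1 - \<tau> * r)) has_real_derivative u \<tau> - u 0 / (1 - \<tau> * r)\<^sup>2) (at \<tau>)"
        using pos[OF \<tau>] by (auto intro!: derivative_eq_intros deriv1 \<tau> simp: r power2_eq_square)
      show "u \<tau> - u 0 / (1 - \<tau> * r)\<^sup>2 \<le> 0"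
        using growth_upper[of \<tau> u u'] \<tau> deriv2 nonneg growth pos[OF \<tau>] by (simp add: r_def)
    qed
    then show ?thesis by simp
  qed
  have "p T - T * p' 0 + T * r + ln (1 - T * r) \<le> p 0 - 0 * p' 0 + 0 * r + ln (1 - 0 * r)"
  proof (rule DERIV_nonpos_imp_nonincreasing[OF T], intro exI conjI)
    fix \<tau> assume \<tau>: "0 \<le> \<tau>" "\<tau> \<le> T"
    show "((\<lambda>\<tau>. p \<tau> - \<tau> * p' 0 + \<tau> * r + ln (1 - \<tau> * r)) has_real_derivative
        p' \<tau> - p' 0 + r - r / (1 - \<tau> * r)) (at \<tau>)"
      using pos[OF \<tau>] by (auto intro!: derivative_eq_intros deriv0 \<tau>)
    show "p' \<tau> - p' 0 + r - r / (1 - \<tau> * r) \<le> 0"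
      using slope[OF \<tau>] by simp
  qed
  then show ?thesis by (simp add: r_def)
qed

end

section \<open>Restriction of convex functions to lines\<close>

lemma open_line_vimage:
  fixes x h :: "'a::real_normed_vector"
  assumes "open Q"
  shows "open {r::real. x + r *\<^sub>R h \<in> Q}"
  using open_vimage[OF assms, of "\<lambda>r. x + r *\<^sub>R h"] by (simp add: vimage_def continuous_intros)

lemma convex_line_vimage:
  fixes x h :: "'a::real_vector"
  assumes "convex Q"
  shows "convex {r::real. x + r *\<^sub>R h \<in> Q}"
proof (rule convexI)
  fix a b u v :: real
  assume *: "a \<in> {r. x + r *\<^sub>R h \<in> Q}" "b \<in> {r. x + r *\<^sub>R h \<in> Q}" "0 \<le> u" "0 \<le> v" "u + v = 1"
  have "u *\<^sub>R (x + a *\<^sub>R h) + v *\<^sub>R (x + b *\<^sub>R h) \<in> Q"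
    using * by (intro convexD[OF assms]) auto
  moreover have "u *\<^sub>R (x + a *\<^sub>R h) + v *\<^sub>R (x + b *\<^sub>R h) = x + (u *\<^sub>R a + v *\<^sub>R b) *\<^sub>R h"
    using * by (simp add: algebra_simps flip: scaleR_add_left)
  ultimately show "u *\<^sub>R a + v *\<^sub>R b \<in> {r. x + r *\<^sub>R h \<in> Q}" by simp
qed

lemma convex_on_line:
  fixes f :: "'a::real_vector \<Rightarrow> real"
  assumes "convex_on Q f"
  shows "convex_on {r::real. x + r *\<^sub>R h \<in> Q} (\<lambda>r. f (x + r *\<^sub>R h))"
proof (rule convex_onI)
  show "convex {r::real. x + r *\<^sub>R h \<in> Q}"
    using assms convex_line_vimage convex_on_imp_convex by blast
  fix t a b :: real
  assume *: "0 < t" "t < 1" "a \<in> {r. x + r *\<^sub>R h \<in> Q}" "b \<in> {r. x + r *\<^sub>R h \<in> Q}"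
  have "x + ((1 - t) *\<^sub>R a + t *\<^sub>R b) *\<^sub>R h = (1 - t) *\<^sub>R (x + a *\<^sub>R h) + t *\<^sub>R (x + b *\<^sub>R h)"
    by (simp add: algebra_simps)
  then show "f (x + ((1 - t) *\<^sub>R a + t *\<^sub>R b) *\<^sub>R h) \<le> (1 - t) * f (x + a *\<^sub>R h) + t * f (x + b *\<^sub>R h)"
    using convex_onD[OF assms, of t "x + a *\<^sub>R h" "x + b *\<^sub>R h"] * by simp
qed

text \<open>Restriction to the line through \<open>x\<close> and \<open>y\<close> reduces this to
  the tangent inequality in one variable; openness of \<open>Q\<close> puts the parameter 0 in the
  interior of the parameter set.\<close>

lemma convex_tangent:
  fixes f :: "'a::real_normed_vector \<Rightarrow> real"
  assumes "open Q" "convex_on Q f" "x \<in> Q" "y \<in> Q" "f differentiable (at x)"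
  shows "f x + D1 f x (y - x) \<le> f y"
proof -
  let ?A = "{r::real. x + r *\<^sub>R (y - x) \<in> Q}"
  have "f (x + 1 *\<^sub>R (y - x)) - f (x + 0 *\<^sub>R (y - x)) \<ge> D1 f x (y - x) * (1 - 0)"
  proof (rule convex_on_imp_above_tangent[where A = ?A and f = "\<lambda>r. f (x + r *\<^sub>R (y - x))"])
    show "convex_on ?A (\<lambda>r. f (x + r *\<^sub>R (y - x)))"
      by (rule convex_on_line[OF assms(2)])
    then show "connected ?A"
      using convex_on_imp_convex convex_connected by blast
    show "0 \<in> interior ?A"
      using open_line_vimage[OF assms(1), of x "y - x"] assms(3) by (simp add: interior_open)
    show "1 \<in> ?A" using assms(4) by simp
    show "((\<lambda>r. f (x + r *\<^sub>R (y - x))) has_real_derivative D1 f x (y - x)) (at 0 within ?A)"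
      using DERIV_along_line[of f x 0 "y - x"] assms(5) by (auto intro: has_field_derivative_at_within)
  qed
  then show ?thesis by simp
qed

section \<open>Self-concordant functions of several variables\<close>

context
  fixes Q :: "'a::euclidean_space set" and f :: "'a \<Rightarrow> real"
  assumes sc: "self_concordant_on Q f"
begin

lemma sc_open: "open Q"
  and sc_differentiable: "x \<in> Q \<Longrightarrow> f differentiable (at x)"
  and sc_D1_differentiable: "x \<in> Q \<Longrightarrow> (\<lambda>y. D1 f y h) differentiable (at x)"
  and sc_D2_differentiable: "x \<in> Q \<Longrightarrow> (\<lambda>y. D2 f y h k) differentiable (at x)"
  using sc unfolding self_concordant_on_def C3_on_def by blast+

lemma sc_deriv:
  assumes "x + \<tau> *\<^sub>R h \<in> Q"
  shows "((\<lambda>r. f (x + r *\<^sub>R h)) has_real_derivative D1 f (x + \<tau> *\<^sub>R h) h) (at \<tau>)"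
    and "((\<lambda>r. D1 f (x + r *\<^sub>R h) k) has_real_derivative D2 f (x + \<tau> *\<^sub>R h) k h) (at \<tau>)"
    and "((\<lambda>r. D2 f (x + r *\<^sub>R h) k l) has_real_derivative D3 f (x + \<tau> *\<^sub>R h) k l h) (at \<tau>)"
proof -
  show "((\<lambda>r. f (x + r *\<^sub>R h)) has_real_derivative D1 f (x + \<tau> *\<^sub>R h) h) (at \<tau>)"
    by (rule DERIV_along_line[OF sc_differentiable[OF assms]])
  show "((\<lambda>r. D1 f (x + r *\<^sub>R h) k) has_real_derivative D2 f (x + \<tau> *\<^sub>R h) k h) (at \<tau>)"
    unfolding D2_def by (rule DERIV_along_line[OF sc_D1_differentiable[OF assms]])
  show "((\<lambda>r. D2 f (x + r *\<^sub>R h) k l) has_real_derivative D3 f (x + \<tau> *\<^sub>R h) k l h) (at \<tau>)"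
    unfolding D3_def by (rule DERIV_along_line[OF sc_D2_differentiable[OF assms]])
qed

lemma sc_tangent:
  assumes "x \<in> Q" "y \<in> Q"
  shows "f x + D1 f x (y - x) \<le> f y"
  using convex_tangent[OF sc_open _ assms sc_differentiable[OF assms(1)]] sc
  by (simp add: self_concordant_on_def)

lemma linear_sc_D1: "x \<in> Q \<Longrightarrow> linear (D1 f x)"
  by (intro linear_D1 sc_differentiable)

text \<open>Adding the tangent inequalities at two points of the line shows that the slope along
  \<open>h\<close> is monotone; the second derivative is the derivative of that slope.\<close>

lemma sc_D2_nonneg:
  assumes "x \<in> Q"
  shows "0 \<le> D2 f x h h"
proof (rule mono_on_imp_deriv_nonneg)
  let ?A = "{r::real. x + r *\<^sub>R h \<in> Q}"
  show "0 \<in> interior ?A"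
    using open_line_vimage[OF sc_open, of x h] assms by (simp add: interior_open)
  show "((\<lambda>r. D1 f (x + r *\<^sub>R h) h) has_real_derivative D2 f x h h) (at 0)"
    using sc_deriv(2)[of x 0 h h] assms by simp
  show "mono_on ?A (\<lambda>r. D1 f (x + r *\<^sub>R h) h)"
  proof (rule mono_onI)
    fix a b assume *: "a \<in> ?A" "b \<in> ?A" "a \<le> b"
    have tan: "f (x + c *\<^sub>R h) + (d - c) * D1 f (x + c *\<^sub>R h) h \<le> f (x + d *\<^sub>R h)"
      if "c \<in> ?A" "d \<in> ?A" for c d
    proof -
      have "(x + d *\<^sub>R h) - (x + c *\<^sub>R h) = (d - c) *\<^sub>R h" by (simp add: algebra_simps)
      then show ?thesis
        using sc_tangent[of "x + c *\<^sub>R h" "x + d *\<^sub>R h"] that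
          linear_cmul[OF linear_sc_D1[of "x + c *\<^sub>R h"]] by simp
    qed
    have "0 \<le> (b - a) * (D1 f (x + b *\<^sub>R h) h - D1 f (x + a *\<^sub>R h) h)"
      using tan[of a b] tan[of b a] * by (simp add: algebra_simps)
    then show "D1 f (x + a *\<^sub>R h) h \<le> D1 f (x + b *\<^sub>R h) h"
      using * by (cases "a = b") (auto simp: zero_le_mult_iff)
  qed
qed

context
  fixes x h :: 'a and T :: real
  assumes T: "0 \<le> T" and segment: "\<And>\<tau>. 0 \<le> \<tau> \<Longrightarrow> \<tau> \<le> T \<Longrightarrow> x + \<tau> *\<^sub>R h \<in> Q"
begin

lemma sc_D3_bound:
  assumes "0 \<le> \<tau>" "\<tau> \<le> T"
  shows "\<bar>D3 f (x + \<tau> *\<^sub>R h) h h h\<bar> \<le> 2 * D2 f (x + \<tau> *\<^sub>R h) h h powr (3/2)"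
  using sc segment[OF assms] by (simp add: self_concordant_on_def)

text \<open>These are the premises of the one-variable bounds, in the order in which those bounds
  expect them.\<close>

lemmas segment_facts =
  T sc_deriv(1)[OF segment] sc_deriv(2)[OF segment] sc_deriv(3)[OF segment]
  sc_D2_nonneg[OF segment] sc_D3_bound

lemma sc_segment_slope:
  "sqrt (D2 f x h h) - sqrt (D2 f x h h) / (1 + T * sqrt (D2 f x h h))
    \<le> D1 f (x + T *\<^sub>R h) h - D1 f x h"
  using sc_slope_lower[of T "\<lambda>r. f (x + r *\<^sub>R h)" "\<lambda>r. D1 f (x + r *\<^sub>R h) h"
      "\<lambda>r. D2 f (x + r *\<^sub>R h) h h" "\<lambda>r. D3 f (x + r *\<^sub>R h) h h h", OF segment_facts]
  by simp

lemma sc_segment_upper: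
  assumes "T * sqrt (D2 f x h h) < 1"
  shows "f (x + T *\<^sub>R h) \<le>
    f x + T * D1 f x h - T * sqrt (D2 f x h h) - ln (1 - T * sqrt (D2 f x h h))"
  using sc_value_upper[of T "\<lambda>r. f (x + r *\<^sub>R h)" "\<lambda>r. D1 f (x + r *\<^sub>R h) h"
      "\<lambda>r. D2 f (x + r *\<^sub>R h) h h" "\<lambda>r. D3 f (x + r *\<^sub>R h) h h h", OF segment_facts] assms
  by simp

end

text \<open>The second argument is the direction of a derivative, so linearity is immediate there.
  For the first argument, linearity of \<open>D1 f\<close> in its direction holds at all points near
  \<open>x\<close> and is differentiated along \<open>b\<close>.\<close>

lemma sc_D2_linear:
  assumes x: "x \<in> Q"
  shows "linear (D2 f x a)" "linear (\<lambda>a. D2 f x a b)"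
proof -
  show "linear (D2 f x a)"
    unfolding D2_def[abs_def] by (rule linear_D1[OF sc_D1_differentiable[OF x]])
  have ev: "eventually (\<lambda>r. x + r *\<^sub>R b \<in> Q) (nhds 0)"
    using open_line_vimage[OF sc_open, of x b] x eventually_nhds_in_open[of "{r. x + r *\<^sub>R b \<in> Q}" 0] by simp
  have d: "((\<lambda>r. D1 f (x + r *\<^sub>R b) c) has_real_derivative D2 f x c b) (at 0)" for c
    using sc_deriv(2)[of x 0 b c] x by simp
  show "linear (\<lambda>a. D2 f x a b)"
  proof (rule linearI)
    fix c d
    have "((\<lambda>r. D1 f (x + r *\<^sub>R b) (c + d)) has_real_derivative D2 f x c b + D2 f x d b) (at 0)"
    proof (subst DERIV_cong_ev[OF refl _ refl])
      show "\<forall>\<^sub>F r in nhds 0. D1 f (x + r *\<^sub>R b) (c + d) = D1 f (x + r *\<^sub>R b) c + D1 f (x + r *\<^sub>R b) d"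
        using ev by eventually_elim (simp add: linear_add[OF linear_sc_D1])
    qed (intro DERIV_add d)
    from DERIV_unique[OF d this] show "D2 f x (c + d) b = D2 f x c b + D2 f x d b" .
  next
    fix l c
    have "((\<lambda>r. D1 f (x + r *\<^sub>R b) (l *\<^sub>R c)) has_real_derivative l * D2 f x c b) (at 0)"
    proof (subst DERIV_cong_ev[OF refl _ refl])
      show "\<forall>\<^sub>F r in nhds 0. D1 f (x + r *\<^sub>R b) (l *\<^sub>R c) = l * D1 f (x + r *\<^sub>R b) c"
        using ev by eventually_elim (simp add: linear_cmul[OF linear_sc_D1])
    qed (intro DERIV_cmult d)
    from DERIV_unique[OF d this] show "D2 f x (l *\<^sub>R c) b = l *\<^sub>R D2 f x c b"
      by simp
  qed
qed

end

section \<open>Logarithmically homogeneous barriers\<close>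

locale log_homogeneous_barrier =
  fixes \<nu> :: real and K :: "'a::euclidean_space set" and F :: "'a \<Rightarrow> ereal"
  assumes barrier: "canonical_barrier \<nu> K F"
begin

abbreviation "Q \<equiv> interior K"
abbreviation "\<phi> \<equiv> re F"

lemma sc: "self_concordant_on Q \<phi>"
  using barrier by (simp add: canonical_barrier_def self_concordant_barrier_def)

lemma F_eq: "x \<in> Q \<Longrightarrow> F x = ereal (\<phi> x)"
  using barrier by (simp add: canonical_barrier_def self_concordant_barrier_def re_def ereal_real)

lemma F_outside: "x \<notin> Q \<Longrightarrow> F x = \<infinity>"
  using barrier by (simp add: canonical_barrier_def self_concordant_barrier_def)

lemma edom_F: "edom F = Q"
  using F_eq F_outside by (force simp: edom_def)

lemma regular_K: "closed K" "convex K" "cone K" "K \<inter> uminus ` K \<subseteq> {0}" "Q \<noteq> {}"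
  using barrier by (auto simp: canonical_barrier_def regular_cone_def)

lemma convex_Q: "convex Q"
  by (rule convex_interior[OF regular_K(2)])

lemma scaleR_Q:
  assumes "x \<in> Q" "0 < c"
  shows "c *\<^sub>R x \<in> Q"
proof -
  have "(*\<^sub>R) c ` Q \<subseteq> Q"
  proof (rule interior_maximal)
    show "(*\<^sub>R) c ` Q \<subseteq> K"
      using regular_K(3) interior_subset[of K] \<open>0 < c\<close> by (force simp: cone_def)
    show "open ((*\<^sub>R) c ` Q)"
      using \<open>0 < c\<close> by (intro open_scaling) auto
  qed
  then show ?thesis using assms(1) by blast
qed

lemma add_Q:
  assumes "x \<in> Q" "y \<in> Q"
  shows "x + y \<in> Q"
proof -
  have "(1/2) *\<^sub>R x + (1/2) *\<^sub>R y \<in> Q"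
    using assms by (intro convexD[OF convex_Q]) auto
  from scaleR_Q[OF this, of 2] show ?thesis by (simp add: scaleR_add_right)
qed

lemma phi_scaleR:
  assumes "x \<in> Q" "0 < c"
  shows "\<phi> (c *\<^sub>R x) = \<phi> x - \<nu> * ln c"
proof -
  have "F (c *\<^sub>R x) = F x - ereal (\<nu> * ln c)"
    using barrier assms by (simp add: canonical_barrier_def)
  then show ?thesis
    using F_eq[OF assms(1)] F_eq[OF scaleR_Q[OF assms]] by simp
qed

lemma near_Q:
  assumes "x \<in> Q"
  shows "eventually (\<lambda>r::real. x + r *\<^sub>R h \<in> Q) (nhds 0)"
  using open_line_vimage[OF open_interior, of x h K] assms
    eventually_nhds_in_open[of "{r. x + r *\<^sub>R h \<in> Q}" 0] by simp

lemma near_pos: "eventually (\<lambda>r::real. 0 < 1 + r) (nhds 0)"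
  using eventually_nhds_in_open[of "{-1<..}" "0::real"] by (simp add: eventually_mono)

section \<open>Euler identities, obtained by differentiating the homogeneity relation\<close>

lemma D1_self:
  assumes x: "x \<in> Q"
  shows "D1 \<phi> x x = - \<nu>"
proof -
  have "((\<lambda>r. \<phi> (x + r *\<^sub>R x)) has_real_derivative - \<nu>) (at 0)"
  proof (subst DERIV_cong_ev[OF refl _ refl])
    show "\<forall>\<^sub>F r in nhds 0. \<phi> (x + r *\<^sub>R x) = \<phi> x - \<nu> * ln (1 + r)"
      using near_pos
    proof eventually_elim
      case (elim r)
      have "x + r *\<^sub>R x = (1 + r) *\<^sub>R x" by (simp add: algebra_simps)
      then show ?case using phi_scaleR[OF x elim] by simp
    qed
    show "((\<lambda>r. \<phi> x - \<nu> * ln (1 + r)) has_real_derivative - \<nu>) (at 0)"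
      by (auto intro!: derivative_eq_intros)
  qed
  moreover have "((\<lambda>r. \<phi> (x + r *\<^sub>R x)) has_real_derivative D1 \<phi> x x) (at 0)"
    using sc_deriv(1)[OF sc, of x 0 x] x by simp
  ultimately show ?thesis using DERIV_unique by blast
qed

lemma D1_scaleR:
  assumes x: "x \<in> Q" and c: "0 < c"
  shows "D1 \<phi> (c *\<^sub>R x) h = D1 \<phi> x h / c"
proof -
  have "((\<lambda>r. \<phi> (x + r *\<^sub>R h)) has_real_derivative D1 \<phi> x h) (at 0)"
    using sc_deriv(1)[OF sc, of x 0 h] x by simp
  then have "((\<lambda>r. \<phi> (x + r *\<^sub>R h)) has_real_derivative D1 \<phi> x h) (at (0 / c))" by simp
  moreover have "((\<lambda>r. r / c) has_real_derivative 1 / c) (at 0)"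
    using c by (auto intro!: derivative_eq_intros)
  ultimately have d: "((\<lambda>r. \<phi> (x + (r / c) *\<^sub>R h)) has_real_derivative D1 \<phi> x h * (1 / c)) (at 0)"
    by (rule DERIV_chain2[where f = "\<lambda>r. \<phi> (x + r *\<^sub>R h)" and g = "\<lambda>r. r / c"])
  have "((\<lambda>r. \<phi> (c *\<^sub>R x + r *\<^sub>R h)) has_real_derivative D1 \<phi> x h * (1 / c)) (at 0)"
  proof (subst DERIV_cong_ev[OF refl _ refl])
    show "\<forall>\<^sub>F r in nhds 0. \<phi> (c *\<^sub>R x + r *\<^sub>R h) = \<phi> (x + (r / c) *\<^sub>R h) - \<nu> * ln c"
      using near_Q[OF scaleR_Q[OF x c], of h]
    proof eventually_elim
      case (elim r)
      have "c *\<^sub>R x + r *\<^sub>R h = c *\<^sub>R (x + (r / c) *\<^sub>R h)"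
        using c by (simp add: scaleR_add_right)
      moreover have "x + (r / c) *\<^sub>R h \<in> Q"
        using scaleR_Q[OF elim, of "1 / c"] c by (simp add: scaleR_add_right)
      ultimately show ?case using phi_scaleR[OF _ c] by simp
    qed
    show "((\<lambda>r. \<phi> (x + (r / c) *\<^sub>R h) - \<nu> * ln c) has_real_derivative D1 \<phi> x h * (1 / c)) (at 0)"
      using DERIV_diff[OF d DERIV_const] by simp
  qed
  moreover have "((\<lambda>r. \<phi> (c *\<^sub>R x + r *\<^sub>R h)) has_real_derivative D1 \<phi> (c *\<^sub>R x) h) (at 0)"
    using sc_deriv(1)[OF sc, of "c *\<^sub>R x" 0 h] scaleR_Q[OF x c] by simp
  ultimately show ?thesis using DERIV_unique by fastforce
qed

lemma D2_self_right:
  assumes x: "x \<in> Q"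
  shows "D2 \<phi> x h x = - D1 \<phi> x h"
proof -
  have "((\<lambda>r. D1 \<phi> (x + r *\<^sub>R x) h) has_real_derivative - D1 \<phi> x h) (at 0)"
  proof (subst DERIV_cong_ev[OF refl _ refl])
    show "\<forall>\<^sub>F r in nhds 0. D1 \<phi> (x + r *\<^sub>R x) h = D1 \<phi> x h / (1 + r)"
      using near_pos
    proof eventually_elim
      case (elim r)
      have "x + r *\<^sub>R x = (1 + r) *\<^sub>R x" by (simp add: algebra_simps)
      then show ?case using D1_scaleR[OF x elim] by simp
    qed
    show "((\<lambda>r. D1 \<phi> x h / (1 + r)) has_real_derivative - D1 \<phi> x h) (at 0)"
      by (auto intro!: derivative_eq_intros)
  qed
  moreover have "((\<lambda>r. D1 \<phi> (x + r *\<^sub>R x) h) has_real_derivative D2 \<phi> x h x) (at 0)"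
    using sc_deriv(2)[OF sc, of x 0 x h] x by simp
  ultimately show ?thesis using DERIV_unique by blast
qed

text \<open>By linearity the left side of \<open>D1 \<phi> y y = - \<nu>\<close> at
  \<open>y = x + r *\<^sub>R h\<close> splits into the two summands differentiated below; their sum
  is constant in \<open>r\<close>, so its derivative at 0 vanishes.\<close>

lemma D2_self_left:
  assumes x: "x \<in> Q"
  shows "D2 \<phi> x x h = - D1 \<phi> x h"
proof -
  have d: "((\<lambda>r. D1 \<phi> (x + r *\<^sub>R h) k) has_real_derivative D2 \<phi> x k h) (at 0)" for k
    using sc_deriv(2)[OF sc, of x 0 h k] x by simp
  have "((\<lambda>r. D1 \<phi> (x + r *\<^sub>R h) x + r * D1 \<phi> (x + r *\<^sub>R h) h) has_real_derivative
      D2 \<phi> x x h + (1 * D1 \<phi> (x + 0 *\<^sub>R h) h + D2 \<phi> x h h * 0)) (at 0)"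
    by (intro DERIV_add DERIV_mult d DERIV_ident)
  moreover have "((\<lambda>r. D1 \<phi> (x + r *\<^sub>R h) x + r * D1 \<phi> (x + r *\<^sub>R h) h) has_real_derivative 0) (at 0)"
  proof (subst DERIV_cong_ev[OF refl _ refl])
    show "\<forall>\<^sub>F r in nhds 0. D1 \<phi> (x + r *\<^sub>R h) x + r * D1 \<phi> (x + r *\<^sub>R h) h = - \<nu>"
      using near_Q[OF x, of h]
    proof eventually_elim
      case (elim r)
      note lin = linear_sc_D1[OF sc elim]
      show ?case
        using D1_self[OF elim] linear_add[OF lin, of x "r *\<^sub>R h"] linear_cmul[OF lin, of r h] by simp
    qed
  qed simp
  ultimately have "D2 \<phi> x x h + D1 \<phi> x h = 0"
    using DERIV_unique by fastforce
  then show ?thesis by simp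
qed

lemma D2_diff_self:
  assumes x: "x \<in> Q"
  shows "D2 \<phi> x (s - x) (s - x) = D2 \<phi> x s s + 2 * D1 \<phi> x s + \<nu>"
proof -
  have "D2 \<phi> x (s - x) b = D2 \<phi> x s b - D2 \<phi> x x b" for b
    by (rule linear_diff[OF sc_D2_linear(2)[OF sc x]])
  moreover have "D2 \<phi> x a (s - x) = D2 \<phi> x a s - D2 \<phi> x a x" for a
    by (rule linear_diff[OF sc_D2_linear(1)[OF sc x]])
  ultimately have "D2 \<phi> x (s - x) (s - x) = D2 \<phi> x s s - D2 \<phi> x s x - (D2 \<phi> x x s - D2 \<phi> x x x)"
    by metis
  then show ?thesis
    using D2_self_right[OF x] D2_self_left[OF x] D1_self[OF x] by simp
qed

section \<open>Boundary behaviour and the size of the barrier parameter\<close>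

text \<open>A ball around 0 inside \<open>K\<close> would contain a nonzero vector together with its
  negative, against pointedness; shrinking any interior point towards 0 shows that 0 is still in the
  closure.\<close>

lemma zero_frontier: "0 \<in> frontier Q"
proof -
  obtain x where x: "x \<in> Q" using regular_K(5) by blast
  have "0 \<notin> Q"
  proof
    assume "0 \<in> Q"
    then obtain e where e: "0 < e" "ball 0 e \<subseteq> K" by (meson mem_interior)
    obtain b :: 'a where b: "b \<in> Basis" using nonempty_Basis by blast
    have "norm ((e/2) *\<^sub>R b) < e" using e b by simp
    then have "(e/2) *\<^sub>R b \<in> ball 0 e" "- ((e/2) *\<^sub>R b) \<in> ball 0 e" by auto
    then have "(e/2) *\<^sub>R b \<in> K \<inter> uminus ` K"
      using e(2) by (metis IntI image_eqI minus_minus subsetD)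
    then show False using regular_K(4) e(1) b nonzero_Basis by fastforce
  qed
  moreover have "0 \<in> closure Q"
  proof (rule closure_sequential[THEN iffD2], intro exI conjI allI)
    show "(1 / real (Suc n)) *\<^sub>R x \<in> Q" for n
      using scaleR_Q[OF x] by simp
    have "(\<lambda>n. (1 / real (Suc n)) *\<^sub>R x) \<longlonglongrightarrow> 0 *\<^sub>R x"
      by (intro tendsto_intros LIMSEQ_Suc[OF lim_1_over_n])
    then show "(\<lambda>n. (1 / real (Suc n)) *\<^sub>R x) \<longlonglongrightarrow> 0" by simp
  qed
  ultimately show ?thesis by (simp add: frontier_def)
qed

text \<open>A sequence in the open set \<open>Q\<close> never hits the frontier point
  \<open>b\<close>, so it converges in the punctured filter for which the barrier property is
  stated.\<close>

lemma blow_up: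
  fixes X :: "nat \<Rightarrow> 'a"
  assumes "b \<in> frontier Q" "\<And>n. X n \<in> Q" "X \<longlonglongrightarrow> b"
  shows "\<exists>n. c < \<phi> (X n)"
proof -
  have "X n \<noteq> b" for n
    using assms(1) assms(2)[of n] by (auto simp: frontier_def)
  then have "filterlim X (at b within Q) sequentially"
    using assms by (auto simp: filterlim_at)
  moreover have "(F \<longlongrightarrow> \<infinity>) (at b within Q)"
    using barrier assms(1) by (simp add: canonical_barrier_def self_concordant_barrier_def)
  ultimately have "((\<lambda>n. F (X n)) \<longlongrightarrow> \<infinity>) sequentially"
    by (rule filterlim_compose[rotated])
  then have "\<forall>\<^sub>F n in sequentially. ereal c < F (X n)"
    by (simp add: tendsto_PInfty)
  then obtain n where "ereal c < F (X n)"
    using eventually_happens trivial_limit_sequentially by blast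
  then show ?thesis using F_eq[OF assms(2)[of n]] by auto
qed

text \<open>Self-concordance in the direction of \<open>x\<close> itself reads \<open>2 \<nu> \<le> 2 \<nu> powr (3/2)\<close>; the case
  \<open>\<nu> = 0\<close> contradicts the blow-up at the origin.\<close>

lemma nu_ge_1: "1 \<le> \<nu>"
proof -
  obtain x where x: "x \<in> Q" using regular_K(5) by blast
  have D2x: "D2 \<phi> y y y = \<nu>" if "y \<in> Q" for y
    using D2_self_left[OF that] D1_self[OF that] by simp
  have "0 \<le> \<nu>" using sc_D2_nonneg[OF sc x, of x] D2x[OF x] by simp
  \<comment> \<open>The Hessian is homogeneous of degree -2, so along the ray its value in the fixed
    direction \<open>x\<close> is \<open>\<nu> / (1 + r)\<^sup>2\<close>; the derivative at 0
    identifies the third derivative.\<close>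
  have "((\<lambda>r. D2 \<phi> (x + r *\<^sub>R x) x x) has_real_derivative - 2 * \<nu>) (at 0)"
  proof (subst DERIV_cong_ev[OF refl _ refl])
    show "\<forall>\<^sub>F r in nhds 0. D2 \<phi> (x + r *\<^sub>R x) x x = \<nu> / (1 + r)\<^sup>2"
      using near_pos
    proof eventually_elim
      case (elim r)
      have eq: "x + r *\<^sub>R x = (1 + r) *\<^sub>R x" by (simp add: algebra_simps)
      define y where "y = (1 + r) *\<^sub>R x"
      have y: "y \<in> Q" unfolding y_def by (rule scaleR_Q[OF x elim])
      have "x = (1 / (1 + r)) *\<^sub>R y" using elim by (simp add: y_def)
      then have "D2 \<phi> y x x = (1 / (1 + r)) * ((1 / (1 + r)) * D2 \<phi> y y y)"
        using linear_cmul[OF sc_D2_linear(1)[OF sc y]] linear_cmul[OF sc_D2_linear(2)[OF sc y]] by simp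
      then show ?case using D2x[OF y] by (simp add: eq y_def power2_eq_square)
    qed
    show "((\<lambda>r. \<nu> / (1 + r)\<^sup>2) has_real_derivative - 2 * \<nu>) (at 0)"
      by (auto intro!: derivative_eq_intros)
  qed
  moreover have "((\<lambda>r. D2 \<phi> (x + r *\<^sub>R x) x x) has_real_derivative D3 \<phi> x x x x) (at 0)"
    using sc_deriv(3)[OF sc, of x 0 x x x] x by simp
  ultimately have "D3 \<phi> x x x x = - 2 * \<nu>" using DERIV_unique by blast
  moreover have "\<bar>D3 \<phi> x x x x\<bar> \<le> 2 * D2 \<phi> x x x powr (3/2)"
    using sc x unfolding self_concordant_on_def by blast
  ultimately have *: "\<nu> \<le> \<nu> powr (3/2)" using \<open>0 \<le> \<nu>\<close> D2x[OF x] by simp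
  have "\<nu> \<noteq> 0"
  proof
    \<comment> \<open>Homogeneity would then make \<open>\<phi>\<close> constant on the ray through
      \<open>x\<close>, although points of that ray tend to the frontier point 0.\<close>
    assume "\<nu> = 0"
    have "(\<lambda>n. (1 / real (Suc n)) *\<^sub>R x) \<longlonglongrightarrow> 0 *\<^sub>R x"
      by (intro tendsto_intros LIMSEQ_Suc[OF lim_1_over_n])
    then obtain n where "\<phi> x < \<phi> ((1 / real (Suc n)) *\<^sub>R x)"
      using blow_up[OF zero_frontier, of "\<lambda>n. (1 / real (Suc n)) *\<^sub>R x" "\<phi> x"] scaleR_Q[OF x] by auto
    then show False using phi_scaleR[OF x, of "1 / real (Suc n)"] \<open>\<nu> = 0\<close> by simp
  qed
  show ?thesis
  proof (rule ccontr)
    assume "\<not> 1 \<le> \<nu>"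
    then have "\<nu> powr (3/2) < \<nu> powr 1"
      using \<open>0 \<le> \<nu>\<close> \<open>\<nu> \<noteq> 0\<close> by (intro powr_less_mono') auto
    then show False using * \<open>0 \<le> \<nu>\<close> by simp
  qed
qed

section \<open>Derivatives in directions of the cone\<close>

text \<open>With a positive slope, the tangent at \<open>x\<close> evaluated at
  \<open>c *\<^sub>R h\<close> would grow linearly in \<open>c\<close>, while
  \<open>\<phi> (c *\<^sub>R h)\<close> decreases logarithmically.\<close>

lemma D1_nonpos:
  assumes x: "x \<in> Q" and h: "h \<in> Q"
  shows "D1 \<phi> x h \<le> 0"
proof (rule ccontr)
  assume "\<not> D1 \<phi> x h \<le> 0"
  then have pos: "0 < D1 \<phi> x h" by simp
  \<comment> \<open>For this \<open>c\<close> the linear term already covers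
    \<open>\<phi> h - \<phi> x\<close>, and \<open>c \<ge> 1\<close> keeps \<open>ln c\<close>
    nonnegative; what remains is \<open>\<nu> \<le> 0\<close>.\<close>
  define c where "c = max 1 ((\<phi> h - \<phi> x) / D1 \<phi> x h)"
  have c: "1 \<le> c" "\<phi> h - \<phi> x \<le> c * D1 \<phi> x h"
    using pos by (auto simp: c_def max_def field_simps)
  have lin: "linear (D1 \<phi> x)" by (rule linear_sc_D1[OF sc x])
  have "\<phi> x + D1 \<phi> x (c *\<^sub>R h - x) \<le> \<phi> (c *\<^sub>R h)"
    using c by (intro sc_tangent[OF sc x] scaleR_Q h) auto
  then have "\<phi> x + c * D1 \<phi> x h + \<nu> \<le> \<phi> h - \<nu> * ln c"
    using c phi_scaleR[OF h, of c] D1_self[OF x] by (simp add: linear_diff[OF lin] linear_cmul[OF lin])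
  moreover have "0 \<le> \<nu> * ln c" using nu_ge_1 c by simp
  ultimately show False using c nu_ge_1 by linarith
qed

text \<open>Along the ray \<open>x + T h\<close> the slope stays nonpositive, while self-concordance forces it to grow by
  nearly the local norm of \<open>h\<close>.\<close>

lemma D2_le_D1:
  assumes x: "x \<in> Q" and h: "h \<in> Q"
  shows "sqrt (D2 \<phi> x h h) \<le> - D1 \<phi> x h"
proof -
  define r where "r = sqrt (D2 \<phi> x h h)"
  have "0 \<le> r" using sc_D2_nonneg[OF sc x] by (simp add: r_def)
  have *: "r - r / (1 + T * r) \<le> - D1 \<phi> x h" if "0 < T" for T
  proof -
    have Q: "x + \<tau> *\<^sub>R h \<in> Q" if "0 \<le> \<tau>" for \<tau>
      using that x add_Q[OF x scaleR_Q[OF h]] by (cases "\<tau> = 0") auto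
    have "D1 \<phi> (x + T *\<^sub>R h) h \<le> 0"
      using that by (intro D1_nonpos h Q) auto
    moreover have "r - r / (1 + T * r) \<le> D1 \<phi> (x + T *\<^sub>R h) h - D1 \<phi> x h"
      unfolding r_def using that Q by (intro sc_segment_slope[OF sc]) auto
    ultimately show ?thesis by linarith
  qed
  have "r \<le> - D1 \<phi> x h + e" if "0 < e" for e
  proof -
    \<comment> \<open>The remainder \<open>r / (1 + T * r)\<close> never exceeds
      \<open>1 / T\<close>, hence the choice \<open>T = 1 / e\<close>.\<close>
    have "r / (1 + (1 / e) * r) \<le> e"
      using \<open>0 \<le> r\<close> that by (simp add: field_simps add_pos_nonneg)
    then show ?thesis using *[of "1 / e"] that by fastforce
  qed
  then show ?thesis unfolding r_def[symmetric] by (rule field_le_epsilon)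
qed

text \<open>For local norm 0 the self-concordant upper bound is just the tangent. Hence
  \<open>\<phi>\<close> stays bounded on bounded pieces of the ray, which cannot reach the frontier,
  where the barrier blows up.\<close>

lemma D2_zero_ray:
  assumes x: "x \<in> Q" and D2: "D2 \<phi> x h h = 0" and "0 \<le> T"
  shows "x + T *\<^sub>R h \<in> Q"
proof (rule ccontr)
  assume out: "x + T *\<^sub>R h \<notin> Q"
  \<comment> \<open>\<open>S\<close> is the closed set of parameters outside \<open>Q\<close>; its
    infimum \<open>m\<close> is the first exit time.\<close>
  define S where "S = {r::real. 0 \<le> r \<and> x + r *\<^sub>R h \<notin> Q}"
  define m where "m = Inf S"
  have "S = {0..} - {r. x + r *\<^sub>R h \<in> Q}" by (auto simp: S_def)
  moreover have "closed ({0..} - {r. x + r *\<^sub>R h \<in> Q})"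
    by (intro closed_Diff closed_atLeast open_line_vimage) auto
  ultimately have "closed S" by simp
  moreover have ne: "S \<noteq> {}" and bdd: "bdd_below S"
    using out \<open>0 \<le> T\<close> by (auto simp: S_def bdd_below_def)
  ultimately have "m \<in> S" unfolding m_def by (intro closed_contains_Inf)
  then have m: "0 < m" "x + m *\<^sub>R h \<notin> Q"
    using x by (cases "m = 0"; auto simp: S_def)+
  have below: "x + r *\<^sub>R h \<in> Q" if "0 \<le> r" "r < m" for r
    using that cInf_lower[OF _ bdd, of r] unfolding m_def[symmetric] by (force simp: S_def)
  \<comment> \<open>The parameters tend to \<open>m\<close> from below, starting at 0 for
    \<open>n = 0\<close>, so the points lie in \<open>Q\<close> and converge to the exit
    point.\<close>
  define X where "X n = x + (m - m / real (Suc n)) *\<^sub>R h" for n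
  have r: "0 \<le> m - m / real (Suc n)" "m - m / real (Suc n) < m" for n
    using m(1) by (auto simp: field_simps)
  have XQ: "X n \<in> Q" for n unfolding X_def using r by (intro below)
  have "(\<lambda>n. x + (m - m * (1 / real (Suc n))) *\<^sub>R h) \<longlonglongrightarrow> x + (m - m * 0) *\<^sub>R h"
    by (intro tendsto_intros LIMSEQ_Suc[OF lim_1_over_n])
  then have lim: "X \<longlonglongrightarrow> x + m *\<^sub>R h" unfolding X_def[abs_def] by simp
  then have "x + m *\<^sub>R h \<in> closure Q" using XQ closure_sequential by blast
  then have "x + m *\<^sub>R h \<in> frontier Q" using m(2) by (simp add: frontier_def)
  then obtain n where n: "\<phi> x + m * \<bar>D1 \<phi> x h\<bar> < \<phi> (X n)"
    using blow_up[OF _ XQ lim] by blast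
  define T where "T = m - m / real (Suc n)"
  have T: "0 \<le> T" "T < m" using r by (auto simp: T_def)
  have "\<phi> (X n) = \<phi> (x + T *\<^sub>R h)" by (simp only: X_def T_def)
  also have "\<dots> \<le> \<phi> x + T * D1 \<phi> x h"
    using sc_segment_upper[OF sc T(1), of x h] below T(2) D2 by simp
  also have "T * D1 \<phi> x h \<le> m * \<bar>D1 \<phi> x h\<bar>"
    using T by (intro order_trans[OF mult_left_mono[OF abs_ge_self] mult_right_mono]) auto
  finally show False using n by simp
qed

text \<open>Scaling \<open>x + n h\<close> by \<open>1 / n\<close> stays in the cone and removes the
  contribution of \<open>x\<close> in the limit; closedness does the rest.\<close>

lemma ray_in_K:
  assumes "\<And>T. 0 \<le> T \<Longrightarrow> x + T *\<^sub>R h \<in> K"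
  shows "h \<in> K"
proof -
  have "(1 / real (Suc n)) *\<^sub>R x + h \<in> K" for n
  proof -
    have "(1 / real (Suc n)) *\<^sub>R (x + real (Suc n) *\<^sub>R h) \<in> K"
      using regular_K(3) assms[of "real (Suc n)"] by (simp only: cone_def) auto
    moreover have "(1 / real (Suc n)) *\<^sub>R (x + real (Suc n) *\<^sub>R h) = (1 / real (Suc n)) *\<^sub>R x + h"
      by (simp only: scaleR_add_right scaleR_scaleR) simp
    ultimately show ?thesis by simp
  qed
  moreover have "(\<lambda>n. (1 / real (Suc n)) *\<^sub>R x + h) \<longlonglongrightarrow> 0 *\<^sub>R x + h"
    by (intro tendsto_intros LIMSEQ_Suc[OF lim_1_over_n])
  ultimately show ?thesis using regular_K(1) unfolding closed_sequential_limits by fastforce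
qed

text \<open>A degenerate direction would make \<open>K\<close> contain a whole line. This matters for the step size
  \<open>x / 0 = 0\<close>: by definiteness of the Hessian the procedure never stalls.\<close>

lemma D2_definite:
  assumes x: "x \<in> Q" and D2: "D2 \<phi> x h h = 0"
  shows "h = 0"
proof -
  have "D2 \<phi> x (- h) (- h) = 0"
    using D2 linear_neg[OF sc_D2_linear(1)[OF sc x]] linear_neg[OF sc_D2_linear(2)[OF sc x]] by simp
  then have "h \<in> K" "- h \<in> K"
    using ray_in_K D2_zero_ray[OF x] D2 interior_subset[of K] by blast+
  then have "h \<in> K \<inter> uminus ` K" by (metis IntI image_eqI minus_minus)
  then show ?thesis using regular_K(4) by blast
qed

end

section \<open>Progress per step and the number of steps\<close>

text \<open>This is \<open>omega_linear\<close> at \<open>u = 1/2\<close>, because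
  \<open>(1 - 1 / 5.3) / 2 = 43/106\<close>. The quadratic Taylor bound of \<open>exp\<close> at
  \<open>43/106\<close> itself stays below \<open>3/2\<close>, so it is taken at an eighth of the
  argument and raised to the eighth power.\<close>

lemma ln_three_halves: "ln (3/2) \<le> (43/106 :: real)"
proof -
  have "(3/2 :: real) \<le> (1 + 43/848 + (43/848)\<^sup>2 / 2) ^ 8"
    by (simp add: power2_eq_square field_simps)
  also have "\<dots> \<le> exp (43/848) ^ 8"
    using exp_lower_Taylor_quadratic[of "43/848 :: real"] by (intro power_mono) auto
  also have "\<dots> = exp (43/106 :: real)"
    by (simp flip: exp_of_nat_mult)
  finally have "ln (3/2) \<le> ln (exp (43/106 :: real))"
    by (subst ln_le_cancel_iff) auto
  then show ?thesis by simp
qed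

text \<open>The tangent of \<open>ln\<close> at \<open>3/2\<close> has slope \<open>2/3\<close>,
  below \<open>43/53 = 1 - 1 / 5.3\<close>; so the inequality at \<open>u = 1/2\<close> persists for
  all larger \<open>u\<close>.\<close>

lemma omega_linear:
  fixes u :: real
  assumes "1/2 \<le> u"
  shows "u / 5.3 \<le> u - ln (1 + u)"
proof -
  have "0 < 1 + (2/3) * (u - 1/2)" using assms by (simp add: field_simps)
  then have "ln (1 + u) = ln (3/2) + ln (1 + (2/3) * (u - 1/2))"
  proof -
    have "(3/2) * (1 + (2/3) * (u - 1/2)) = 1 + u" by (simp add: field_simps)
    with \<open>0 < 1 + _\<close> show ?thesis
      using ln_mult_pos[of "3/2" "1 + (2/3) * (u - 1/2)"] by (simp only: zero_less_divide_iff zero_less_numeral simp_thms)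
  qed
  also have "\<dots> \<le> 43/106 + (2/3) * (u - 1/2)"
    using assms by (intro add_mono ln_three_halves ln_add_one_self_le_self) simp
  finally have "ln (1 + u) \<le> 43/106 + (2/3) * (u - 1/2)" .
  also have "\<dots> \<le> (43 / 53) * u"
    using assms by (simp add: field_simps)
  finally show ?thesis by (simp add: field_simps)
qed

lemma omega_quadratic:
  fixes u :: real
  assumes "0 \<le> u" "u \<le> 1/2"
  shows "u\<^sup>2 / 3 \<le> u - ln (1 + u)"
proof -
  have "0 - ln (1 + 0) - 0\<^sup>2 / 3 \<le> u - ln (1 + u) - u\<^sup>2 / 3"
  proof (rule DERIV_nonneg_imp_nondecreasing[OF assms(1)], intro exI conjI)
    fix v assume v: "0 \<le> v" "v \<le> u"
    show "((\<lambda>v. v - ln (1 + v) - v\<^sup>2 / 3) has_real_derivative 1 - 1 / (1 + v) - 2 * v / 3) (at v)"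
      using v by (auto intro!: derivative_eq_intros)
    \<comment> \<open>The factor \<open>1 - 2 * v\<close> shows where the range limit
      \<open>1/2\<close> comes from.\<close>
    have "1 - 1 / (1 + v) - 2 * v / 3 = v * (1 - 2 * v) / (3 * (1 + v))"
      using v by (simp add: field_simps)
    also have "\<dots> \<ge> 0" using v assms by simp
    finally show "0 \<le> 1 - 1 / (1 + v) - 2 * v / 3" .
  qed
  then show ?thesis by simp
qed

lemma omega_mono:
  fixes u v :: real
  assumes "0 \<le> u" "u \<le> v"
  shows "u - ln (1 + u) \<le> v - ln (1 + v)"
proof -
  have "1 + (v - u) / (1 + u) = (1 + v) / (1 + u)"
    using assms by (simp add: field_simps)
  then have "ln (1 + v) - ln (1 + u) = ln (1 + (v - u) / (1 + u))"
    using assms by (simp add: ln_div)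
  also have "\<dots> \<le> (v - u) / (1 + u)"
    using assms by (intro ln_add_one_self_le_self) auto
  also have "\<dots> \<le> v - u"
    using assms mult_right_mono[of 1 "1 + u" "v - u"] by (simp add: field_simps)
  finally show ?thesis by linarith
qed

text \<open>The difference of the two sides has derivative
  \<open>v\<^sup>2 / (2 * (1 - v)\<^sup>2)\<close>. The estimate serves for full steps, where it
  yields a decrease of half of \<open>\<gamma>\<close>.\<close>

lemma neg_ln_upper:
  fixes e :: real
  assumes "0 \<le> e" "e < 1"
  shows "- e - ln (1 - e) \<le> e\<^sup>2 / (2 * (1 - e))"
proof -
  have "0\<^sup>2 / (2 * (1 - 0)) + 0 + ln (1 - 0) \<le> e\<^sup>2 / (2 * (1 - e)) + e + ln (1 - e)"
  proof (rule DERIV_nonneg_imp_nondecreasing[OF assms(1)], intro exI conjI)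
    fix v assume v: "0 \<le> v" "v \<le> e"
    show "((\<lambda>v. v\<^sup>2 / (2 * (1 - v)) + v + ln (1 - v)) has_real_derivative
        (2 * v * (2 * (1 - v)) + v\<^sup>2 * 2) / (2 * (1 - v))\<^sup>2 + 1 - 1 / (1 - v)) (at v)"
      using v assms by (auto intro!: derivative_eq_intros simp: power2_eq_square)
    define w where "w = 1 - v"
    have w: "v = 1 - w" "0 < w" using v assms by (auto simp: w_def)
    have "(2 * v * (2 * (1 - v)) + v\<^sup>2 * 2) / (2 * (1 - v))\<^sup>2 + 1 - 1 / (1 - v) = v\<^sup>2 / (2 * (1 - v)\<^sup>2)"
      unfolding w(1) using w(2) by (simp add: field_simps power2_eq_square)
    then show "0 \<le> (2 * v * (2 * (1 - v)) + v\<^sup>2 * 2) / (2 * (1 - v))\<^sup>2 + 1 - 1 / (1 - v)"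
      by simp
  qed
  then show ?thesis by simp
qed

text \<open>The untruncated step maximizes the guaranteed decrease: there
  \<open>\<alpha> * e = \<gamma> / (e + \<gamma>)\<close>, and the decrease equals
  \<open>\<gamma> / e - ln (1 + \<gamma> / e)\<close>.\<close>

lemma step_decrease:
  fixes \<gamma> e A :: real
  defines "\<alpha> \<equiv> min 1 (\<gamma> / (e * (e + \<gamma>)))"
  assumes pos: "0 < \<gamma>" "0 < e" and A: "1 \<le> A" "e \<le> A + \<gamma>"
  shows "0 < \<alpha>" "\<alpha> * e < 1"
    and "A \<le> \<gamma> \<Longrightarrow> \<gamma> / (5.3 * (A + \<gamma>)) \<le> \<alpha> * \<gamma> + \<alpha> * e + ln (1 - \<alpha> * e)"
    and "\<gamma> < A \<Longrightarrow> \<gamma>\<^sup>2 / (12 * A\<^sup>2) \<le> \<alpha> * \<gamma> + \<alpha> * e + ln (1 - \<alpha> * e)"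
proof -
  let ?d = "\<alpha> * \<gamma> + \<alpha> * e + ln (1 - \<alpha> * e)"
  \<comment> \<open>By \<open>e \<le> A + \<gamma>\<close> this is a lower bound for
    \<open>\<gamma> / e\<close>; it passes \<open>1/2\<close>, where the two omega bounds meet,
    exactly at \<open>\<gamma> = A\<close>.\<close>
  define u where "u = \<gamma> / (A + \<gamma>)"
  show "0 < \<alpha>" using pos by (simp add: \<alpha>_def)
  have "\<alpha> * e \<le> \<gamma> / (e * (e + \<gamma>)) * e"
    using pos by (intro mult_right_mono) (auto simp: \<alpha>_def)
  also have "\<dots> = \<gamma> / (e + \<gamma>)" using pos by simp
  also have "\<dots> < 1" using pos by simp
  finally show "\<alpha> * e < 1" .
  have "u - ln (1 + u) \<le> ?d \<or> \<gamma> / 2 \<le> ?d"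
  proof (cases "\<gamma> / (e * (e + \<gamma>)) < 1")
    case True
    then have \<alpha>: "\<alpha> = \<gamma> / (e * (e + \<gamma>))" by (simp add: \<alpha>_def)
    have "\<alpha> * \<gamma> + \<alpha> * e = \<alpha> * (e + \<gamma>)" by (simp add: algebra_simps)
    also have "\<dots> = \<gamma> / e" using add_pos_pos[OF pos] by (simp add: \<alpha> add.commute)
    finally have "\<alpha> * \<gamma> + \<alpha> * e = \<gamma> / e" .
    moreover have "1 - \<alpha> * e = 1 / (1 + \<gamma> / e)"
    proof -
      have "\<alpha> * e = \<gamma> / (e + \<gamma>)" using pos by (simp add: \<alpha>)
      then show ?thesis using pos add_pos_pos[OF pos] by (simp add: field_simps)
    qed
    moreover have "ln (1 / (1 + \<gamma> / e)) = - ln (1 + \<gamma> / e)"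
      using pos by (simp add: ln_div add_pos_pos)
    ultimately have "?d = \<gamma> / e - ln (1 + \<gamma> / e)" by simp
    moreover have "u - ln (1 + u) \<le> \<gamma> / e - ln (1 + \<gamma> / e)"
      using pos A by (intro omega_mono) (auto simp: u_def intro!: divide_left_mono)
    ultimately show ?thesis by simp
  next
    case False
    then have \<alpha>: "\<alpha> = 1" by (simp add: \<alpha>_def)
    then have "e < 1" using \<open>\<alpha> * e < 1\<close> by simp
    \<comment> \<open>Truncation at 1 means \<open>e\<^sup>2 \<le> \<gamma> * (1 - e)\<close>, which
      is what \<open>neg_ln_upper\<close> needs.\<close>
    have "e * (e + \<gamma>) \<le> \<gamma>"
      using False pos mult_pos_pos[OF pos(2) add_pos_pos[OF pos(2,1)]] by (simp add: not_less le_divide_eq)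
    then have "e\<^sup>2 / (2 * (1 - e)) \<le> \<gamma> / 2"
      using \<open>e < 1\<close> by (simp add: field_simps power2_eq_square)
    then have "\<gamma> / 2 \<le> \<gamma> + e + ln (1 - e)"
      using neg_ln_upper[of e] pos \<open>e < 1\<close> by linarith
    then show ?thesis by (simp add: \<alpha>)
  qed
  then consider "u - ln (1 + u) \<le> ?d" | "\<gamma> / 2 \<le> ?d" by blast
  note cases = this
  show "\<gamma> / (5.3 * (A + \<gamma>)) \<le> ?d" if "A \<le> \<gamma>"
  proof (cases rule: cases)
    case 1
    have "1/2 \<le> u" using that A pos by (simp add: u_def field_simps)
    then have "u / 5.3 \<le> ?d" using omega_linear[of u] 1 by linarith
    moreover have "u / 5.3 = \<gamma> / (5.3 * (A + \<gamma>))"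
      unfolding u_def by (simp only: divide_divide_eq_left mult.commute)
    ultimately show ?thesis by simp
  next
    case 2
    have "\<gamma> / (5.3 * (A + \<gamma>)) \<le> \<gamma> / 2"
      using that A pos by (intro divide_left_mono) auto
    then show ?thesis using 2 by simp
  qed
  show "\<gamma>\<^sup>2 / (12 * A\<^sup>2) \<le> ?d" if "\<gamma> < A"
  proof (cases rule: cases)
    case 1
    \<comment> \<open>The constant 12 is 4 from squaring this bound times 3 from
      \<open>omega_quadratic\<close>.\<close>
    have "\<gamma> / (2 * A) \<le> u" unfolding u_def using that A pos by (intro divide_left_mono) auto
    then have "(\<gamma> / (2 * A))\<^sup>2 \<le> u\<^sup>2" using pos A by (intro power_mono) auto
    moreover have "u \<le> 1/2" "0 \<le> u" using that A pos by (auto simp: u_def field_simps)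
    ultimately have "(\<gamma> / (2 * A))\<^sup>2 / 3 \<le> ?d" using omega_quadratic[of u] 1 by linarith
    moreover have "(\<gamma> / (2 * A))\<^sup>2 / 3 = \<gamma>\<^sup>2 / (12 * A\<^sup>2)" by (simp add: power2_eq_square)
    ultimately show ?thesis by simp
  next
    case 2
    have "\<gamma>\<^sup>2 / (12 * A\<^sup>2) = \<gamma> * (\<gamma> / (12 * A\<^sup>2))" by (simp add: power2_eq_square)
    also have "\<dots> \<le> \<gamma> * (1/2)"
    proof (intro mult_left_mono)
      have "1 * A \<le> 6 * A * A" using A by (intro mult_right_mono) auto
      then have "\<gamma> \<le> 6 * A * A" using that by linarith
      then show "\<gamma> / (12 * A\<^sup>2) \<le> 1/2" using A by (simp add: power2_eq_square field_simps)
    qed (use pos in simp)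
    finally show ?thesis using 2 by simp
  qed
qed

section \<open>Counting the two kinds of steps\<close>

text \<open>Stated for a bare real sequence and with a strict conclusion, so that choosing
  \<open>N\<close> equal to the bound gives a contradiction.\<close>

lemma two_phase_count:
  fixes D :: "nat \<Rightarrow> real" and \<nu> \<Omega> t \<eta> \<delta> \<theta> :: real
  defines "A \<equiv> \<nu> + t * \<Omega>"
  assumes params: "0 < \<eta>" "0 < \<theta>" "0 < t" "0 < \<delta>" "\<delta> \<le> 1" and A: "1 \<le> A"
    and above: "\<And>j. j \<le> N \<Longrightarrow> \<eta> + \<theta> < D j"
    and step: "\<And>j. j < N \<Longrightarrow> \<exists>\<gamma>\<ge>t * \<delta> * (D j - \<theta>).
        A \<le> \<gamma> \<and> \<gamma> / (5.3 * (A + \<gamma>)) \<le> t * (D j - D (Suc j)) \<or>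
        \<gamma> < A \<and> \<gamma>\<^sup>2 / (12 * A\<^sup>2) \<le> t * (D j - D (Suc j))"
  shows "int N < icg_bound \<nu> \<Omega> t \<eta> \<delta> \<theta> (D 0)"
proof -
  define h where "h j = D j - \<theta>" for j
  \<comment> \<open>\<open>c\<close> is the relative decrease of \<open>h\<close> guaranteed by a
    step with \<open>A \<le> \<gamma>\<close>, made uniform by putting \<open>h 0\<close> in the
    denominator; \<open>q\<close> is the growth of \<open>1 / h\<close> guaranteed by any other
    step.\<close>
  define c where "c = \<delta> / (5.3 * (A + t * \<delta> * h 0))"
  define q where "q = t * \<delta>\<^sup>2 / (12 * A\<^sup>2)"
  have h_gt: "\<eta> < h j" and h_pos: "0 < h j" if "j \<le> N" for j
    using above[OF that] params by (auto simp: h_def)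
  have h0: "0 < h 0" by (rule h_pos) simp
  have den: "0 < A + t * \<delta> * h 0" using A params h0 by (simp add: add_pos_pos)
  have c: "0 < c" using params den by (simp add: c_def)
  have q: "0 < q" using params A by (simp add: q_def)
  \<comment> \<open>Here \<open>a\<close> counts the contracting steps and \<open>b\<close> the
    others. The last conjunct concerns the value just before the latest contracting step, whence
    \<open>a - 1\<close>; it survives later steps of the other kind.\<close>
  have *: "\<exists>a b. a + b = j \<and> h j \<le> h 0 \<and> h j \<le> h 0 * exp (- c * real a) \<and>
      1 / h 0 + q * real b \<le> 1 / h j \<and>
      (0 < a \<longrightarrow> 1 / (10.6 * t) - \<theta> < h 0 * exp (- c * (real a - 1)))" if "j \<le> N" for j
    using that
  proof (induction j)
    case 0
    show ?case by (intro exI[of _ 0]) simp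
  next
    case (Suc j)
    then obtain a b where ab: "a + b = j" "h j \<le> h 0" "h j \<le> h 0 * exp (- c * real a)"
      "1 / h 0 + q * real b \<le> 1 / h j"
      "0 < a \<longrightarrow> 1 / (10.6 * t) - \<theta> < h 0 * exp (- c * (real a - 1))" by auto
    have hj: "0 < h j" and hj': "0 < h (Suc j)" using Suc.prems by (auto intro: h_pos)
    define \<beta> where "\<beta> = t * \<delta> * h j"
    have \<beta>: "0 < \<beta>" using params hj by (simp add: \<beta>_def)
    have diff: "D j - D (Suc j) = h j - h (Suc j)" by (simp add: h_def)
    obtain \<gamma> where \<gamma>: "\<beta> \<le> \<gamma>"
      "A \<le> \<gamma> \<and> \<gamma> / (5.3 * (A + \<gamma>)) \<le> t * (h j - h (Suc j)) \<or>
       \<gamma> < A \<and> \<gamma>\<^sup>2 / (12 * A\<^sup>2) \<le> t * (h j - h (Suc j))"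
      using step[of j] Suc.prems unfolding \<beta>_def diff by (auto simp: h_def)
    from \<gamma>(2) show ?case
    proof (elim disjE conjE)
      assume I: "A \<le> \<gamma>" "\<gamma> / (5.3 * (A + \<gamma>)) \<le> t * (h j - h (Suc j))"
      \<comment> \<open>\<open>A \<le> \<gamma>\<close> makes
        \<open>\<gamma> / (A + \<gamma>)\<close> at least \<open>1/2\<close>, and 10.6 is twice
        5.3.\<close>
      have "1 / 10.6 \<le> \<gamma> / (5.3 * (A + \<gamma>))" using I A by (simp add: field_simps)
      then have "1 / 10.6 \<le> t * (h j - h (Suc j))" using I by linarith
      then have "1 / (10.6 * t) \<le> h j - h (Suc j)" using params by (simp add: field_simps)
      then have last: "1 / (10.6 * t) - \<theta> < h j" using hj' params by linarith
      have "c * h j * t \<le> \<beta> / (5.3 * (A + \<beta>))"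
      proof -
        have "\<beta> \<le> t * \<delta> * h 0" using ab(2) params by (simp add: \<beta>_def)
        then have "\<beta> / (5.3 * (A + t * \<delta> * h 0)) \<le> \<beta> / (5.3 * (A + \<beta>))"
          using \<beta> A by (intro divide_left_mono) auto
        then show ?thesis by (simp add: c_def \<beta>_def mult_ac)
      qed
      also have "\<dots> \<le> \<gamma> / (5.3 * (A + \<gamma>))"
        using \<gamma>(1) \<beta> A by (simp add: field_simps)
      finally have "t * (c * h j) \<le> t * (h j - h (Suc j))" using I by (simp add: mult_ac)
      then have "c * h j \<le> h j - h (Suc j)" using params by simp
      then have "h (Suc j) \<le> (1 - c) * h j" by (simp add: algebra_simps)
      also have "\<dots> \<le> exp (- c) * h j"
        using hj exp_ge_add_one_self[of "- c"] by (intro mult_right_mono) auto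
      also have "\<dots> \<le> exp (- c) * (h 0 * exp (- c * real a))"
        using ab(3) by (intro mult_left_mono) auto
      also have "\<dots> = h 0 * exp (- c * real (Suc a))"
        by (simp add: algebra_simps flip: exp_add)
      finally have new: "h (Suc j) \<le> h 0 * exp (- c * real (Suc a))" .
      have le: "h (Suc j) \<le> h j"
        using \<open>c * h j \<le> h j - h (Suc j)\<close> mult_pos_pos[OF c hj] by linarith
      then have "1 / h j \<le> 1 / h (Suc j)" using hj' by (simp add: frac_le)
      then show ?thesis
        using ab new le last by (intro exI[of _ "Suc a"] exI[of _ b]) auto
    next
      assume II: "\<gamma> < A" "\<gamma>\<^sup>2 / (12 * A\<^sup>2) \<le> t * (h j - h (Suc j))"
      have "t * (q * (h j)\<^sup>2) = \<beta>\<^sup>2 / (12 * A\<^sup>2)"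
        by (simp add: q_def \<beta>_def power2_eq_square)
      also have "\<dots> \<le> \<gamma>\<^sup>2 / (12 * A\<^sup>2)"
        using \<gamma>(1) \<beta> by (intro divide_right_mono power_mono) auto
      finally have "t * (q * (h j)\<^sup>2) \<le> t * (h j - h (Suc j))" using II by linarith
      then have dec: "q * (h j)\<^sup>2 \<le> h j - h (Suc j)" using params by simp
      then have le: "h (Suc j) \<le> h j" using q by (smt (verit) mult_nonneg_nonneg zero_le_power2)
      \<comment> \<open>Replacing one factor \<open>h j\<close> by the smaller
        \<open>h (Suc j)\<close> allows division by the product, which turns the quadratic decrease
        into additive growth of the reciprocal.\<close>
      have "q * (h j * h (Suc j)) \<le> q * (h j * h j)"
        using le hj q by (intro mult_left_mono) auto
      also have "\<dots> \<le> h j - h (Suc j)" using dec by (simp add: power2_eq_square)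
      finally have "1 / h j + q \<le> 1 / h (Suc j)"
        using hj hj' by (simp add: field_simps)
      then have "1 / h 0 + q * real (Suc b) \<le> 1 / h (Suc j)"
        using ab(4) by (simp add: algebra_simps)
      then show ?thesis
        using ab le by (intro exI[of _ a] exI[of _ "Suc b"]) auto
    qed
  qed
  obtain a b where ab: "a + b = N" "h N \<le> h 0 * exp (- c * real a)"
      "1 / h 0 + q * real b \<le> 1 / h N"
      "0 < a \<longrightarrow> 1 / (10.6 * t) - \<theta> < h 0 * exp (- c * (real a - 1))"
    using *[of N] by auto
  have hN: "\<eta> < h N" by (rule h_gt) simp
  define M where "M = 12 * A\<^sup>2 / (t * \<delta>\<^sup>2) * max (1 / \<eta> - 1 / h 0) 0"
  define L where "L = 5.3 * (t * \<delta> * h 0 + A) / \<delta> * ln (log_arg t \<eta> \<theta> (D 0))"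
  have "1 / h N < 1 / \<eta>" using hN params by (simp add: frac_less2)
  then have "q * real b < max (1 / \<eta> - 1 / h 0) 0" using ab(3) by linarith
  then have "real b < (1 / q) * max (1 / \<eta> - 1 / h 0) 0" using q by (simp add: field_simps)
  then have "real b < M" by (simp add: M_def q_def)
  then have b: "int b < \<lceil>M\<rceil>" by (simp add: less_ceiling_iff)
  have a: "int a \<le> max 0 \<lceil>L\<rceil>"
  proof (cases "a = 0")
    case False
    \<comment> \<open>\<open>E\<close> is the inverse of the contraction accumulated before the last
      contracting step; both candidates in the minimum inside the logarithm are shown to exceed
      it.\<close>
    define E where "E = exp (c * (real a - 1))"
    have E: "0 < E" "exp (- c * (real a - 1)) = 1 / E"
      by (auto simp: E_def exp_minus inverse_eq_divide)
    have D0: "h 0 < D 0" using params by (simp add: h_def)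
    have "h 0 * exp (- c * real a) \<le> h 0 * (1 / E)"
      unfolding E(2)[symmetric] using c h0 by (intro mult_left_mono) auto
    then have "\<eta> < h 0 / E" using hN ab(2) by simp
    then have "E < h 0 / \<eta>" using E(1) params by (simp add: field_simps)
    also have "\<dots> < D 0 / \<eta>" using D0 params by (simp add: divide_strict_right_mono)
    finally have 1: "E < D 0 / \<eta>" .
    \<comment> \<open>The premise \<open>0 < w\<close> matches \<open>log_arg\<close>, where this
      candidate counts only if the positive part is nonzero.\<close>
    have 2: "E < 10.6 * t * D 0 / w" if w: "w = 1 - 10.6 * t * \<theta>" "0 < w" for w
    proof -
      have "w / (10.6 * t) = 1 / (10.6 * t) - \<theta>" using params by (simp add: w field_simps)
      also have "\<dots> < h 0 / E" using ab(4) False E(2) by simp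
      finally have "E < 10.6 * t * h 0 / w" using w(2) E(1) params by (simp add: field_simps)
      also have "\<dots> < 10.6 * t * D 0 / w"
        using w(2) D0 params by (simp add: divide_strict_right_mono)
      finally show ?thesis .
    qed
    have "E < log_arg t \<eta> \<theta> (D 0)"
      using 1 2[OF refl] by (simp add: log_arg_def max_def)
    then have "ln E < ln (log_arg t \<eta> \<theta> (D 0))" using E(1) by simp
    then have "c * (real a - 1) < ln (log_arg t \<eta> \<theta> (D 0))" by (simp add: E_def)
    then have "real a - 1 < (1 / c) * ln (log_arg t \<eta> \<theta> (D 0))" using c by (simp add: field_simps)
    also have "\<dots> = L" by (simp add: L_def c_def add.commute)
    finally have "int a - 1 < \<lceil>L\<rceil>" by (simp add: less_ceiling_iff)
    then show ?thesis by simp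
  qed simp
  have "icg_bound \<nu> \<Omega> t \<eta> \<delta> \<theta> (D 0) = max 0 \<lceil>L\<rceil> + \<lceil>M\<rceil> + 1"
    by (simp add: icg_bound_def L_def M_def A_def h_def add.assoc)
  then show ?thesis using a b ab(1) by linarith
qed

section \<open>The conditional gradient procedure\<close>

lemma convex_step:
  fixes x y :: "'a::real_vector"
  assumes "convex A" "x \<in> A" "y \<in> A" "0 \<le> \<alpha>" "\<alpha> \<le> 1"
  shows "x + \<alpha> *\<^sub>R (y - x) \<in> A"
proof -
  have "(1 - \<alpha>) *\<^sub>R x + \<alpha> *\<^sub>R y \<in> A" using assms by (intro convexD) auto
  then show ?thesis by (simp add: algebra_simps)
qed

section \<open>Feasible points and real-valued forms of the potential and the gap\<close>

locale icg_setting = log_homogeneous_barrier \<nu> Kc F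
  for \<nu> :: real and Kc :: "'e::euclidean_space set" and F :: "'e \<Rightarrow> ereal" +
  fixes g :: "'e \<Rightarrow> ereal" and X :: "'e set" and z :: 'e and s :: "'e \<Rightarrow> 'e"
    and t \<eta> \<delta> \<theta> :: real
  assumes g_proper: "proper_fun g"
    and g_convex: "convex (epi g)"
    and Omega_finite: "Omega g X < \<infinity>"
    and X_convex: "convex X"
    and C_nonempty: "feasible F g X \<noteq> {}"
    and params: "0 < \<eta>" "0 < \<theta>" "0 < t" "0 < \<delta>" "\<delta> \<le> 1"
    and z_argmin: "is_arg_min (potential F g t) (\<lambda>x. x \<in> X) z"
    and s_inexact: "inexact_oracle F g X t \<delta> \<theta> s"
begin

abbreviation "C \<equiv> feasible F g X"
abbreviation "\<gamma> \<equiv> re g"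
abbreviation "\<Omega> \<equiv> real_of_ereal (Omega g X)"

text \<open>\<open>v\<close> and \<open>G\<close> are the real-valued counterparts of
  \<open>potential F g t\<close> and \<open>tGap F g t s\<close>; \<open>potential_eq\<close> and
  \<open>tGap_eq\<close> give the agreement on \<open>C\<close>.\<close>

definition v :: "'e \<Rightarrow> real" where "v x = \<phi> x / t + \<gamma> x"
definition G :: "'e \<Rightarrow> real" where "G x = D1 \<phi> x (x - s x) / t + (\<gamma> x - \<gamma> (s x))"

lemma C_iff: "x \<in> C \<longleftrightarrow> x \<in> X \<and> x \<in> Q \<and> x \<in> edom g"
  by (auto simp: feasible_def edom_F)

lemma g_eq: "x \<in> edom g \<Longrightarrow> g x = ereal (\<gamma> x)"
  using g_proper by (auto simp: proper_fun_def edom_def re_def ereal_real)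

lemma g_convexD:
  assumes "x \<in> edom g" "y \<in> edom g" "0 \<le> \<alpha>" "\<alpha> \<le> 1"
  shows "x + \<alpha> *\<^sub>R (y - x) \<in> edom g" "\<gamma> (x + \<alpha> *\<^sub>R (y - x)) \<le> \<gamma> x + \<alpha> * (\<gamma> y - \<gamma> x)"
proof -
  have "(1 - \<alpha>) *\<^sub>R (x, \<gamma> x) + \<alpha> *\<^sub>R (y, \<gamma> y) \<in> epi g"
    using assms g_eq by (intro convexD[OF g_convex]) (auto simp: epi_def)
  moreover have "(1 - \<alpha>) *\<^sub>R x + \<alpha> *\<^sub>R y = x + \<alpha> *\<^sub>R (y - x)" by (simp add: algebra_simps)
  moreover have "(1 - \<alpha>) * \<gamma> x + \<alpha> * \<gamma> y = \<gamma> x + \<alpha> * (\<gamma> y - \<gamma> x)" by (simp add: algebra_simps)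
  ultimately have *: "g (x + \<alpha> *\<^sub>R (y - x)) \<le> ereal (\<gamma> x + \<alpha> * (\<gamma> y - \<gamma> x))"
    by (simp add: epi_def)
  then show "x + \<alpha> *\<^sub>R (y - x) \<in> edom g" by (auto simp: edom_def)
  from g_eq[OF this] * show "\<gamma> (x + \<alpha> *\<^sub>R (y - x)) \<le> \<gamma> x + \<alpha> * (\<gamma> y - \<gamma> x)" by simp
qed

lemma C_step: "x \<in> C \<Longrightarrow> y \<in> C \<Longrightarrow> 0 \<le> \<alpha> \<Longrightarrow> \<alpha> \<le> 1 \<Longrightarrow> x + \<alpha> *\<^sub>R (y - x) \<in> C"
  by (simp add: C_iff convex_step[OF X_convex] convex_step[OF convex_Q] g_convexD(1))

lemma potential_eq: "x \<in> C \<Longrightarrow> potential F g t x = ereal (v x)"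
  by (simp add: C_iff potential_def F_eq g_eq v_def)

text \<open>Comparison with a feasible point makes the potential at \<open>z\<close> finite, hence
  both of its summands.\<close>

lemma z_in_C: "z \<in> C"
proof -
  obtain x where x: "x \<in> C" using C_nonempty by blast
  have "z \<in> X" "potential F g t z \<le> potential F g t x"
    using z_argmin x by (auto simp: is_arg_min_def C_iff not_less)
  then have fin: "potential F g t z \<noteq> \<infinity>" using potential_eq[OF x] by auto
  have "g z \<noteq> - \<infinity>" using g_proper by (simp add: proper_fun_def)
  have "z \<in> Q"
  proof (rule ccontr)
    assume "z \<notin> Q"
    then show False using fin F_outside[of z] params \<open>g z \<noteq> - \<infinity>\<close> by (simp add: potential_def)
  qed
  moreover have "z \<in> edom g"
    using fin F_eq[OF \<open>z \<in> Q\<close>] by (cases "g z") (auto simp: potential_def edom_def)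
  ultimately show ?thesis using \<open>z \<in> X\<close> by (simp add: C_iff)
qed

lemma s_in_C: "x \<in> C \<Longrightarrow> s x \<in> C"
  using s_inexact by (simp add: inexact_oracle_def)

lemma Gam_eq:
  "x \<in> C \<Longrightarrow> y \<in> C \<Longrightarrow> Gam F g t x y = ereal (D1 \<phi> x (x - y) / t + (\<gamma> x - \<gamma> y))"
  by (simp add: C_iff Gam_def g_eq)

lemma tGap_eq: "x \<in> C \<Longrightarrow> tGap F g t s x = ereal (G x)"
  by (simp add: tGap_def G_def Gam_eq s_in_C)

text \<open>The exact gap dominates the suboptimality: \<open>z\<close> competes in the supremum,
  and the tangent inequality for \<open>\<phi>\<close> bounds its term from below. The oracle
  condition transfers this to \<open>G\<close>.\<close>

lemma G_lower:
  assumes x: "x \<in> C"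
  shows "\<delta> * (v x - v z - \<theta>) \<le> G x"
proof -
  have Q: "x \<in> Q" "z \<in> Q" and "z \<in> X" using x z_in_C by (auto simp: C_iff)
  have "D1 \<phi> x (x - z) = - D1 \<phi> x (z - x)"
    using linear_neg[OF linear_sc_D1[OF sc Q(1)], of "z - x"] by simp
  then have "\<phi> x - \<phi> z \<le> D1 \<phi> x (x - z)" using sc_tangent[OF sc Q] by simp
  then have "(\<phi> x - \<phi> z) / t \<le> D1 \<phi> x (x - z) / t" using params by (intro divide_right_mono) auto
  then have "v x - v z \<le> D1 \<phi> x (x - z) / t + (\<gamma> x - \<gamma> z)"
    by (simp add: v_def diff_divide_distrib)
  then have "ereal (v x - v z) \<le> Gam F g t x z" by (simp add: Gam_eq[OF x z_in_C])
  also have "\<dots> \<le> Gap F g X t x" unfolding Gap_def by (intro SUP_upper \<open>z \<in> X\<close>)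
  finally have "ereal (v x - v z) - ereal \<theta> \<le> Gap F g X t x - ereal \<theta>"
    by (intro ereal_minus_mono) auto
  then have "ereal \<delta> * (ereal (v x - v z) - ereal \<theta>) \<le> ereal \<delta> * (Gap F g X t x - ereal \<theta>)"
    using params by (intro ereal_mult_left_mono) auto
  also have "\<dots> \<le> Gam F g t x (s x)" using s_inexact x by (simp add: inexact_oracle_def)
  finally show ?thesis using tGap_eq[OF x] by (simp add: tGap_def)
qed

section \<open>The local norm of the search direction\<close>

lemma Omega_bound:
  assumes "x \<in> C" "y \<in> C"
  shows "\<bar>\<gamma> x - \<gamma> y\<bar> \<le> \<Omega>"
proof -
  have *: "(x, y) \<in> (edom g \<inter> X) \<times> (edom g \<inter> X)" using assms by (auto simp: C_iff)
  have "(case (x, y) of (x, y) \<Rightarrow> \<bar>g x - g y\<bar>) \<le> Omega g X"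
    unfolding Omega_def by (rule SUP_upper[OF *])
  then have "ereal \<bar>\<gamma> x - \<gamma> y\<bar> \<le> Omega g X" using assms by (simp add: C_iff g_eq)
  then show ?thesis using Omega_finite by (cases "Omega g X") auto
qed

lemma Omega_nonneg: "0 \<le> \<Omega>"
  using Omega_bound[OF z_in_C z_in_C] by simp

text \<open>Up to the variation of \<open>g\<close>, \<open>b = - D1 \<phi> x (s x)\<close> is
  \<open>\<nu> + t * G x\<close>. The squared norm is at most
  \<open>b\<^sup>2 - 2 * b + \<nu>\<close>, which \<open>(max b \<nu>)\<^sup>2\<close>
  dominates.\<close>

lemma te_upper:
  assumes x: "x \<in> C" and G: "0 \<le> G x"
  shows "te F s x \<le> \<nu> + t * \<Omega> + t * G x"
proof -
  have Q: "x \<in> Q" "s x \<in> Q" using x s_in_C by (auto simp: C_iff)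
  note lin = linear_sc_D1[OF sc Q(1)]
  define b where "b = - D1 \<phi> x (s x)"
  have b0: "0 \<le> b" using D1_nonpos[OF Q] by (simp add: b_def)
  have "D1 \<phi> x (x - s x) = b - \<nu>"
    using D1_self[OF Q(1)] by (simp add: linear_diff[OF lin] b_def)
  then have "t * G x = b - \<nu> + t * (\<gamma> x - \<gamma> (s x))"
    using params by (simp add: G_def distrib_left)
  moreover have "t * \<bar>\<gamma> x - \<gamma> (s x)\<bar> \<le> t * \<Omega>"
    using Omega_bound[OF x s_in_C[OF x]] params by (intro mult_left_mono) auto
  moreover have "t * - \<bar>\<gamma> x - \<gamma> (s x)\<bar> \<le> t * (\<gamma> x - \<gamma> (s x))"
    using params by (intro mult_left_mono) auto
  ultimately have b: "b \<le> \<nu> + t * \<Omega> + t * G x" by simp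
  have nonneg: "0 \<le> t * \<Omega>" "0 \<le> t * G x" using params Omega_nonneg G by auto
  have "sqrt (D2 \<phi> x (s x) (s x)) \<le> b" using D2_le_D1[OF Q] by (simp add: b_def)
  then have "D2 \<phi> x (s x) (s x) \<le> b\<^sup>2"
    by (rule sqrt_le_D)
  then have e2: "D2 \<phi> x (s x - x) (s x - x) \<le> b\<^sup>2 - 2 * b + \<nu>"
    by (simp add: D2_diff_self[OF Q(1)] b_def)
  have "te F s x \<le> max b \<nu>"
    unfolding te_def
  proof (rule real_le_lsqrt)
    show "0 \<le> max b \<nu>" using b0 by simp
    show "D2 \<phi> x (s x - x) (s x - x) \<le> (max b \<nu>)\<^sup>2"
    \<comment> \<open>In the first case the terms \<open>- 2 * b + \<nu>\<close> drop out; in the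
      second \<open>b\<close> is so small that \<open>\<nu>\<^sup>2\<close> absorbs everything, by
      \<open>\<nu> \<ge> 1\<close>.\<close>
    proof (cases "\<nu> \<le> 2 * b")
      case True
      then have "b\<^sup>2 - 2 * b + \<nu> \<le> b\<^sup>2" by simp
      also have "\<dots> \<le> (max b \<nu>)\<^sup>2" using b0 by (intro power_mono) auto
      finally show ?thesis using e2 by simp
    next
      case False
      have "b * (b - 2) \<le> \<nu> * (\<nu> - 1)"
      proof (cases "b \<le> 2")
        case True
        then have "b * (b - 2) \<le> 0" using b0 by (simp add: mult_nonneg_nonpos)
        also have "0 \<le> \<nu> * (\<nu> - 1)" using nu_ge_1 by simp
        finally show ?thesis .
      next
        case False
        then show ?thesis using \<open>\<not> \<nu> \<le> 2 * b\<close> b0 by (intro mult_mono) auto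
      qed
      then have "b\<^sup>2 - 2 * b + \<nu> \<le> \<nu>\<^sup>2" by (simp add: power2_eq_square algebra_simps)
      also have "\<dots> \<le> (max b \<nu>)\<^sup>2" using nu_ge_1 by (intro power_mono) auto
      finally show ?thesis using e2 by simp
    qed
  qed
  then show ?thesis using b nonneg by simp
qed

text \<open>A positive gap excludes \<open>s x = x\<close>, and the Hessian is definite.\<close>

lemma te_pos:
  assumes x: "x \<in> C" and G: "0 < G x"
  shows "0 < te F s x"
proof -
  have Q: "x \<in> Q" using x by (simp add: C_iff)
  have "s x \<noteq> x"
    using G linear_0[OF linear_sc_D1[OF sc Q]] by (auto simp: G_def)
  then have "D2 \<phi> x (s x - x) (s x - x) \<noteq> 0" using D2_definite[OF Q] by force
  then show ?thesis using sc_D2_nonneg[OF sc Q, of "s x - x"] by (simp add: te_def)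
qed

text \<open>The self-concordant upper bound for \<open>\<phi>\<close> and convexity of
  \<open>g\<close> along the segment add up to exactly the expression estimated in
  \<open>step_decrease\<close>, with \<open>t * G x\<close> as its \<open>\<gamma>\<close>.\<close>

lemma icg_step:
  fixes x
  defines "x' \<equiv> x + step_size F g t s x *\<^sub>R (s x - x)" and "A \<equiv> \<nu> + t * \<Omega>"
  assumes x: "x \<in> C" and G: "0 < G x"
  shows "x' \<in> C"
    and "A \<le> t * G x \<and> t * G x / (5.3 * (A + t * G x)) \<le> t * (v x - v x') \<or>
         t * G x < A \<and> (t * G x)\<^sup>2 / (12 * A\<^sup>2) \<le> t * (v x - v x')"
proof -
  define e where "e = te F s x"
  define \<alpha> where "\<alpha> = min 1 (t * G x / (e * (e + t * G x)))"
  have Q: "x \<in> Q" "s x \<in> Q" and dom: "x \<in> edom g" "s x \<in> edom g"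
    using x s_in_C[OF x] by (auto simp: C_iff)
  have x': "x' = x + \<alpha> *\<^sub>R (s x - x)"
    by (simp add: x'_def step_size_def Let_def \<alpha>_def e_def re_def tGap_eq[OF x])
  have A1: "1 \<le> A" using nu_ge_1 Omega_nonneg params by (simp add: A_def add_increasing2)
  have "0 < t * G x" "0 < e" "e \<le> A + t * G x"
    using params G te_pos[OF x G] te_upper[OF x] by (auto simp: e_def A_def)
  note dec = step_decrease[OF this(1,2) A1 this(3), folded \<alpha>_def]
  have \<alpha>1: "\<alpha> \<le> 1" by (simp add: \<alpha>_def)
  show "x' \<in> C" unfolding x' using dec(1) \<alpha>1 by (intro C_step x s_in_C) auto
  have "\<phi> x' \<le> \<phi> x + \<alpha> * D1 \<phi> x (s x - x) - \<alpha> * e - ln (1 - \<alpha> * e)"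
    unfolding x' e_def te_def
  proof (rule sc_segment_upper[OF sc])
    show "x + \<tau> *\<^sub>R (s x - x) \<in> Q" if "0 \<le> \<tau>" "\<tau> \<le> \<alpha>" for \<tau>
      using that \<alpha>1 by (intro convex_step[OF convex_Q Q]) auto
    show "\<alpha> * sqrt (D2 \<phi> x (s x - x) (s x - x)) < 1" using dec(2) by (simp add: e_def te_def)
  qed (use dec(1) in simp)
  moreover have "t * \<gamma> x' \<le> t * (\<gamma> x + \<alpha> * (\<gamma> (s x) - \<gamma> x))"
    unfolding x' using dec(1) \<alpha>1 dom params by (intro mult_left_mono g_convexD(2)) auto
  moreover have "t * (v x - v x') = \<phi> x - \<phi> x' + (t * \<gamma> x - t * \<gamma> x')"
    using params by (simp add: v_def distrib_left right_diff_distrib)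
  moreover have "\<alpha> * (t * G x) = - (\<alpha> * D1 \<phi> x (s x - x)) - t * (\<alpha> * (\<gamma> (s x) - \<gamma> x))"
    using linear_neg[OF linear_sc_D1[OF sc Q(1)], of "s x - x"] params
    by (simp add: G_def distrib_left right_diff_distrib)
  ultimately have "\<alpha> * (t * G x) + \<alpha> * e + ln (1 - \<alpha> * e) \<le> t * (v x - v x')"
    by (simp add: algebra_simps)
  then show "A \<le> t * G x \<and> t * G x / (5.3 * (A + t * G x)) \<le> t * (v x - v x') \<or>
         t * G x < A \<and> (t * G x)\<^sup>2 / (12 * A\<^sup>2) \<le> t * (v x - v x')"
    using dec(3,4) by linarith
qed

text \<open>By contradiction: if no iterate up to the bound met the target, the procedure would
  still be running, and \<open>two_phase_count\<close> would make the bound smaller than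
  itself.\<close>

lemma icg_reaches:
  assumes x0: "x0 \<in> C"
  shows "\<exists>k x. icg F g t s \<eta> \<delta> x0 k = Some x \<and> x \<in> C \<and> v x - v z \<le> \<eta> + \<theta> \<and>
    int k \<le> icg_bound \<nu> \<Omega> t \<eta> \<delta> \<theta> (v x0 - v z)"
proof (rule ccontr)
  let ?icg = "icg F g t s \<eta> \<delta> x0"
  define N where "N = nat (icg_bound \<nu> \<Omega> t \<eta> \<delta> \<theta> (v x0 - v z))"
  \<comment> \<open>Nonnegativity ensures that \<open>nat\<close> in the definition of
    \<open>N\<close> does not change the value.\<close>
  have "0 \<le> icg_bound \<nu> \<Omega> t \<eta> \<delta> \<theta> (v x0 - v z)"
  proof -
    have "0 \<le> 12 * (\<nu> + t * \<Omega>)\<^sup>2 / (t * \<delta>\<^sup>2) * max (1 / \<eta> - 1 / (v x0 - v z - \<theta>)) 0"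
      using params by (intro mult_nonneg_nonneg divide_nonneg_nonneg) auto
    from ceiling_mono[OF this] show ?thesis by (simp add: icg_bound_def)
  qed
  then have N: "int N = icg_bound \<nu> \<Omega> t \<eta> \<delta> \<theta> (v x0 - v z)" by (simp add: N_def)
  assume "\<not> ?thesis"
  then have high: "\<eta> + \<theta> < v x - v z" if "?icg k = Some x" "x \<in> C" "k \<le> N" for k x
    using that N by (metis not_less of_nat_le_iff)
  define y where "y k = the (?icg k)" for k
  \<comment> \<open>While the target is missed, \<open>G_lower\<close> keeps the approximate gap
    above \<open>\<eta> * \<delta>\<close>, so the stopping test fails and the next iterate
    exists.\<close>
  have G: "\<eta> * \<delta> < G x" if "?icg k = Some x" "x \<in> C" "k \<le> N" for k x
  proof -
    have "\<delta> * \<eta> < \<delta> * (v x - v z - \<theta>)" using high[OF that] params by simp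
    also have "\<dots> \<le> G x" by (rule G_lower[OF that(2)])
    finally show ?thesis by (simp add: mult.commute)
  qed
  have G_pos: "0 < G x" if "?icg k = Some x" "x \<in> C" "k \<le> N" for k x
    using G[OF that] params mult_pos_pos[of \<eta> \<delta>] by linarith
  have Suc_eq: "?icg (Suc k) = Some (x + step_size F g t s x *\<^sub>R (s x - x))"
    if "?icg k = Some x" "x \<in> C" "k \<le> N" for k x
    using that G[OF that] by (simp add: tGap_eq)
  have run: "\<exists>x. ?icg k = Some x \<and> x \<in> C" if "k \<le> N" for k
    using that
  proof (induction k)
    case 0
    then show ?case using x0 by simp
  next
    case (Suc k)
    then obtain x where x: "?icg k = Some x" "x \<in> C" "k \<le> N" by auto
    show ?case using Suc_eq[OF x] icg_step(1)[OF x(2) G_pos[OF x]] by blast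
  qed
  then have y: "?icg k = Some (y k)" "y k \<in> C" if "k \<le> N" for k
    using that by (force simp: y_def)+
  have "int N < icg_bound \<nu> \<Omega> t \<eta> \<delta> \<theta> (v (y 0) - v z)"
  proof (rule two_phase_count[where D = "\<lambda>k. v (y k) - v z", OF params])
    show "1 \<le> \<nu> + t * \<Omega>"
      using nu_ge_1 Omega_nonneg params by (simp add: add_increasing2)
    show "\<eta> + \<theta> < v (y j) - v z" if "j \<le> N" for j
      using high[OF y[OF that] that] .
    fix j assume "j < N"
    then have j: "j \<le> N" "Suc j \<le> N" by auto
    have Suc: "y (Suc j) = y j + step_size F g t s (y j) *\<^sub>R (s (y j) - y j)"
      using Suc_eq[OF y[OF j(1)] j(1)] y(1)[OF j(2)] by simp
    have "t * (\<delta> * (v (y j) - v z - \<theta>)) \<le> t * G (y j)"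
      using G_lower[OF y(2)[OF j(1)]] params by (intro mult_left_mono) auto
    then show "\<exists>\<gamma>\<ge>t * \<delta> * (v (y j) - v z - \<theta>).
        \<nu> + t * \<Omega> \<le> \<gamma> \<and> \<gamma> / (5.3 * (\<nu> + t * \<Omega> + \<gamma>)) \<le> t * (v (y j) - v z - (v (y (Suc j)) - v z)) \<or>
        \<gamma> < \<nu> + t * \<Omega> \<and> \<gamma>\<^sup>2 / (12 * (\<nu> + t * \<Omega>)\<^sup>2) \<le> t * (v (y j) - v z - (v (y (Suc j)) - v z))"
      using icg_step(2)[OF y(2)[OF j(1)] G_pos[OF y[OF j(1)] j(1)], folded Suc]
      by (intro exI[of _ "t * G (y j)"]) (simp add: mult.assoc)
  qed
  moreover have "y 0 = x0" by (simp add: y_def)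
  ultimately show False using N by simp
qed

end

theorem proposition4p3:
  fixes g :: "'e::euclidean_space \<Rightarrow> ereal"
    and f :: "'h::euclidean_space \<Rightarrow> ereal"
    and K :: "'h set"
    and P :: "'e \<Rightarrow> 'h"
    and F :: "'e \<Rightarrow> ereal"
    and X :: "'e set"
    and z x0 :: 'e
    and s :: "'e \<Rightarrow> 'e"
    and \<nu> t \<eta> \<delta> \<theta> :: real
    and \<Delta> :: "'e \<Rightarrow> ereal"
  assumes g_proper: "proper_fun g"
    and g_closed: "closed (epi g)"
    and g_convex: "convex (epi g)"
    and g_cont: "continuous_on (edom g) g"
    and Omega_finite: "Omega g X < \<infinity>"
    and f_barrier: "canonical_barrier \<nu> K f"
    and P_linear: "linear P"
    and F_def: "F = (\<lambda>x. f (P x))"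
    and F_barrier: "canonical_barrier \<nu> (P -` K) F"
    and F_dom: "edom F = interior (P -` K)"
    and X: "X \<noteq> {}" "compact X" "convex X"
    and C_nonempty: "feasible F g X \<noteq> {}"
    and params: "\<eta> > 0" "\<theta> > 0" "t > 0" "0 < \<delta>" "\<delta> \<le> 1"
    and z_argmin: "is_arg_min (potential F g t) (\<lambda>x. x \<in> X) z"
    and \<Delta>_def: "\<Delta> = (\<lambda>x. potential F g t x - potential F g t z)"
    and s_inexact: "inexact_oracle F g X t \<delta> \<theta> s"
    and x0: "x0 \<in> feasible F g X"
  shows "\<exists>k x. icg F g t s \<eta> \<delta> x0 k = Some x \<and> \<Delta> x \<le> ereal (\<eta> + \<theta>) \<and>
           (\<forall>j<k. \<forall>y. icg F g t s \<eta> \<delta> x0 j = Some y \<longrightarrow> \<not> \<Delta> y \<le> ereal (\<eta> + \<theta>)) \<and>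
           int k \<le> icg_bound \<nu> (real_of_ereal (Omega g X)) t \<eta> \<delta> \<theta> (real_of_ereal (\<Delta> x0))"
proof -
  interpret icg_setting \<nu> "P -` K" F g X z s t \<eta> \<delta> \<theta>
    by unfold_locales fact+
  have \<Delta>_eq: "\<Delta> x = ereal (v x - v z)" if "x \<in> C" for x
    using that by (simp add: \<Delta>_def potential_eq z_in_C)
  \<comment> \<open>The first index satisfying \<open>R\<close> is at most the one found by
    \<open>icg_reaches\<close>, so the bound carries over to it.\<close>
  define R where "R k \<longleftrightarrow> (\<exists>x. icg F g t s \<eta> \<delta> x0 k = Some x \<and> \<Delta> x \<le> ereal (\<eta> + \<theta>))" for k
  obtain k where k: "R k" "int k \<le> icg_bound \<nu> \<Omega> t \<eta> \<delta> \<theta> (v x0 - v z)"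
    using icg_reaches[OF x0] \<Delta>_eq unfolding R_def by fastforce
  have "(LEAST k. R k) \<le> k" by (rule Least_le[of R, OF k(1)])
  then have "int (LEAST k. R k) \<le> icg_bound \<nu> \<Omega> t \<eta> \<delta> \<theta> (real_of_ereal (\<Delta> x0))"
    using k(2) by (simp add: \<Delta>_eq[OF x0])
  moreover have "R (LEAST k. R k)" by (rule LeastI[of R, OF k(1)])
  moreover have "\<not> R j" if "j < (LEAST k. R k)" for j using not_less_Least[OF that] .
  ultimately show ?thesis unfolding R_def by blast
qed

end
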